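(* Let $\mathcal X$ and $\mathcal Y$ be infinite dimensional complex Banach spaces, let $A\in L(\mathcal X)$ and $B\in L(\mathcal Y)$, and let $\rho\colon L(\mathcal Y,\mathcal X)\to L(\mathcal Y,\mathcal X)$ be the generalized derivation defined by $A$ and $B$, i.e. $\rho(U)=AU-UB$ for $U\in L(\mathcal Y,\mathcal X)$. Then $$\sigma_{DR}(\rho)=(\sigma_{DR}(A)-\sigma(B))\cup(\sigma(A)-\sigma_{DR}(B)).$$
   Context: $L(\mathcal Y,\mathcal X)$ is the Banach space of bounded linear maps from $\mathcal Y$ to $\mathcal X$ and $L(\mathcal X)=L(\mathcal X,\mathcal X)$. For $S,T\subseteq\mathbb C$, $S-T=\{s-t: s\in S,\ t\in T\}$ (empty if $S$ or $T$ is empty). $\sigma(T)$ denotes the spectrum of a bounded operator $T$ on a Banach space. $T$ is Drazin invertible if there are a bounded operator $S$ on the same space and $m\in\mathbb N$ with $T^m=T^mST$, $STS=S$, $TS=ST$; the Drazin spectrum is $\sigma_{DR}(T)=\{\lambda\in\mathbb C: T-\lambda$ is not Drazin invertible$\}$. *)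

theory Defs
  imports "HOL-Analysis.Analysis"
begin

section \<open>Complex normed and Banach spaces\<close>

class scaleC =
  fixes scaleC :: "complex \<Rightarrow> 'a \<Rightarrow> 'a" (infixr "*\<^sub>C" 75)

class complex_normed_vector = real_normed_vector + scaleC +
  assumes scaleC_add_right: "c *\<^sub>C (x + y) = c *\<^sub>C x + c *\<^sub>C y"
    and scaleC_add_left: "(c + d) *\<^sub>C x = c *\<^sub>C x + d *\<^sub>C x"
    and scaleC_scaleC: "c *\<^sub>C (d *\<^sub>C x) = (c * d) *\<^sub>C x"
    and scaleC_one: "1 *\<^sub>C x = x"
    and scaleR_scaleC: "r *\<^sub>R x = complex_of_real r *\<^sub>C x"
    and norm_scaleC: "norm (c *\<^sub>C x) = cmod c * norm x"

class complex_banach = complex_normed_vector + banach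

global_interpretation complex_vector:
  vector_space "scaleC :: complex \<Rightarrow> 'a \<Rightarrow> 'a::complex_normed_vector"
  by unfold_locales (simp_all add: scaleC_add_right scaleC_add_left scaleC_scaleC scaleC_one)

text \<open>The type argument carries the space; dimension is taken over the complex numbers.\<close>

definition infinite_dimensional :: "'a::complex_normed_vector itself \<Rightarrow> bool" where
  "infinite_dimensional _ \<longleftrightarrow>
    (\<nexists>S :: 'a set. finite S \<and> complex_vector.span S = UNIV)"

lemma bounded_linear_scaleC: "bounded_linear (\<lambda>x. c *\<^sub>C (x :: 'a::complex_normed_vector))"
  by (rule bounded_linear_intro[where K = "cmod c"])
    (simp_all add: scaleC_add_right scaleR_scaleC scaleC_scaleC norm_scaleC mult.commute)


section \<open>The Banach space of bounded complex linear maps\<close>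

text \<open>
  A bounded complex linear map is a bounded real linear map that also commutes with complex
  scalars; the operator norm is the one of the ambient space of bounded real linear maps.
\<close>

typedef (overloaded) ('a, 'b) cblinfun ("(_ \<Rightarrow>\<^sub>C\<^sub>L /_)" [22, 21] 21) =
  "{f :: 'a::complex_normed_vector \<Rightarrow>\<^sub>L 'b::complex_normed_vector.
      \<forall>c x. blinfun_apply f (c *\<^sub>C x) = c *\<^sub>C blinfun_apply f x}"
  morphisms blinfun_of_cblinfun Abs_cblinfun
  by (rule exI[of _ 0]) simp

setup_lifting type_definition_cblinfun

lift_definition cblinfun_apply ::
  "('a::complex_normed_vector \<Rightarrow>\<^sub>C\<^sub>L 'b::complex_normed_vector) \<Rightarrow> 'a \<Rightarrow> 'b"
  is blinfun_apply .

instantiation cblinfun :: (complex_normed_vector, complex_normed_vector) complex_normed_vector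
begin

lift_definition zero_cblinfun :: "'a \<Rightarrow>\<^sub>C\<^sub>L 'b" is 0 by simp

lift_definition plus_cblinfun :: "('a \<Rightarrow>\<^sub>C\<^sub>L 'b) \<Rightarrow> ('a \<Rightarrow>\<^sub>C\<^sub>L 'b) \<Rightarrow> ('a \<Rightarrow>\<^sub>C\<^sub>L 'b)" is "(+)"
  by (simp add: blinfun.add_left scaleC_add_right)

lift_definition uminus_cblinfun :: "('a \<Rightarrow>\<^sub>C\<^sub>L 'b) \<Rightarrow> ('a \<Rightarrow>\<^sub>C\<^sub>L 'b)" is uminus
  by (simp add: blinfun.minus_left)

lift_definition minus_cblinfun :: "('a \<Rightarrow>\<^sub>C\<^sub>L 'b) \<Rightarrow> ('a \<Rightarrow>\<^sub>C\<^sub>L 'b) \<Rightarrow> ('a \<Rightarrow>\<^sub>C\<^sub>L 'b)" is "(-)"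
  by (simp add: blinfun.diff_left complex_vector.scale_right_diff_distrib)

lift_definition scaleR_cblinfun :: "real \<Rightarrow> ('a \<Rightarrow>\<^sub>C\<^sub>L 'b) \<Rightarrow> ('a \<Rightarrow>\<^sub>C\<^sub>L 'b)" is "(*\<^sub>R)"
  by (simp add: blinfun.scaleR_left scaleR_scaleC scaleC_scaleC mult.commute)

lift_definition scaleC_cblinfun :: "complex \<Rightarrow> ('a \<Rightarrow>\<^sub>C\<^sub>L 'b) \<Rightarrow> ('a \<Rightarrow>\<^sub>C\<^sub>L 'b)"
  is "\<lambda>c f. blinfun_compose (Blinfun ((*\<^sub>C) c)) f"
  by (simp add: bounded_linear_Blinfun_apply[OF bounded_linear_scaleC] scaleC_scaleC mult.commute)

lift_definition norm_cblinfun :: "('a \<Rightarrow>\<^sub>C\<^sub>L 'b) \<Rightarrow> real" is norm .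

lift_definition dist_cblinfun :: "('a \<Rightarrow>\<^sub>C\<^sub>L 'b) \<Rightarrow> ('a \<Rightarrow>\<^sub>C\<^sub>L 'b) \<Rightarrow> real" is dist .

definition sgn_cblinfun :: "('a \<Rightarrow>\<^sub>C\<^sub>L 'b) \<Rightarrow> ('a \<Rightarrow>\<^sub>C\<^sub>L 'b)" where
  "sgn_cblinfun f = scaleR (inverse (norm f)) f"

definition uniformity_cblinfun :: "(('a \<Rightarrow>\<^sub>C\<^sub>L 'b) \<times> ('a \<Rightarrow>\<^sub>C\<^sub>L 'b)) filter" where
  "uniformity_cblinfun = (INF e\<in>{0<..}. principal {(f, g). dist f g < e})"

definition open_cblinfun :: "('a \<Rightarrow>\<^sub>C\<^sub>L 'b) set \<Rightarrow> bool" where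
  "open_cblinfun U \<longleftrightarrow> (\<forall>f\<in>U. \<forall>\<^sub>F (f', g) in uniformity. f' = f \<longrightarrow> g \<in> U)"

instance
proof
  fix f g h :: "'a \<Rightarrow>\<^sub>C\<^sub>L 'b" and r s :: real and c d :: complex
  show "f + g + h = f + (g + h)" by transfer simp
  show "f + g = g + f" by transfer simp
  show "0 + f = f" by transfer simp
  show "- f + f = 0" by transfer simp
  show "f - g = f + - g" by transfer simp
  show "r *\<^sub>R (f + g) = r *\<^sub>R f + r *\<^sub>R g" by transfer (simp add: scaleR_add_right)
  show "(r + s) *\<^sub>R f = r *\<^sub>R f + s *\<^sub>R f" by transfer (simp add: scaleR_add_left)
  show "r *\<^sub>R s *\<^sub>R f = (r * s) *\<^sub>R f" by transfer simp
  show "1 *\<^sub>R f = f" by transfer simp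
  show "dist f g = norm (f - g)" by transfer (simp add: dist_norm)
  show "sgn f = inverse (norm f) *\<^sub>R f" by (fact sgn_cblinfun_def)
  show "uniformity = (INF e\<in>{0<..}. principal {(f :: 'a \<Rightarrow>\<^sub>C\<^sub>L 'b, g). dist f g < e})"
    by (fact uniformity_cblinfun_def)
  show "open U = (\<forall>f\<in>U. \<forall>\<^sub>F (f', g) in uniformity. f' = f \<longrightarrow> g \<in> U)"
    for U :: "('a \<Rightarrow>\<^sub>C\<^sub>L 'b) set"
    by (fact open_cblinfun_def)
  show "(norm f = 0) = (f = 0)" by transfer simp
  show "norm (f + g) \<le> norm f + norm g" by transfer (rule norm_triangle_ineq)
  show "norm (r *\<^sub>R f) = \<bar>r\<bar> * norm f" by transfer simp
  note apply_scaleC = bounded_linear_Blinfun_apply[OF bounded_linear_scaleC]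
  show "c *\<^sub>C (f + g) = c *\<^sub>C f + c *\<^sub>C g"
    by transfer (auto intro!: blinfun_eqI simp: apply_scaleC blinfun.add_left scaleC_add_right)
  show "(c + d) *\<^sub>C f = c *\<^sub>C f + d *\<^sub>C f"
    by transfer (auto intro!: blinfun_eqI simp: apply_scaleC blinfun.add_left scaleC_add_left)
  show "c *\<^sub>C d *\<^sub>C f = (c * d) *\<^sub>C f"
    by transfer (auto intro!: blinfun_eqI simp: apply_scaleC scaleC_scaleC)
  show "1 *\<^sub>C f = f"
    by transfer (auto intro!: blinfun_eqI simp: apply_scaleC scaleC_one)
  show "r *\<^sub>R f = complex_of_real r *\<^sub>C f"
    by transfer (auto intro!: blinfun_eqI simp: apply_scaleC blinfun.scaleR_left scaleR_scaleC)
  show "norm (c *\<^sub>C f) = cmod c * norm f"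
  proof transfer
    fix c and f :: "'a \<Rightarrow>\<^sub>L 'b"
    have le: "norm (Blinfun ((*\<^sub>C) c) o\<^sub>L f) \<le> cmod c * norm f" for c and f :: "'a \<Rightarrow>\<^sub>L 'b"
      using norm_blinfun[of f]
      by (intro norm_blinfun_bound)
        (auto simp: apply_scaleC norm_scaleC mult.assoc intro: mult_left_mono)
    have "cmod c * norm f \<le> norm (Blinfun ((*\<^sub>C) c) o\<^sub>L f)"
    proof (cases "c = 0")
      case False
      have "Blinfun ((*\<^sub>C) (inverse c)) o\<^sub>L (Blinfun ((*\<^sub>C) c) o\<^sub>L f) = f"
        using False by (auto intro!: blinfun_eqI simp: apply_scaleC scaleC_scaleC scaleC_one)
      with le[of "inverse c" "Blinfun ((*\<^sub>C) c) o\<^sub>L f"]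
      have "norm f \<le> inverse (cmod c) * norm (Blinfun ((*\<^sub>C) c) o\<^sub>L f)"
        by (simp add: norm_inverse)
      with False show ?thesis by (simp add: field_simps)
    qed simp
    with le[of c f] show "norm (Blinfun ((*\<^sub>C) c) o\<^sub>L f) = cmod c * norm f" by simp
  qed
qed

end

lemma cblinfun_eqI: "(\<And>x. cblinfun_apply f x = cblinfun_apply g x) \<Longrightarrow> f = g"
  by transfer (rule blinfun_eqI)

lemma cblinfun_apply_scaleC_left: "cblinfun_apply (c *\<^sub>C f) x = c *\<^sub>C cblinfun_apply f x"
  by transfer (simp add: bounded_linear_Blinfun_apply[OF bounded_linear_scaleC])

lemma norm_cblinfun_eq_onorm: "norm f = onorm (cblinfun_apply f)"
  by transfer (rule norm_blinfun.rep_eq)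

lemma bounded_linear_cblinfun_apply: "bounded_linear (cblinfun_apply f)"
  by transfer (rule blinfun.bounded_linear_right)

lemma cblinfun_apply_scaleC_right: "cblinfun_apply f (c *\<^sub>C x) = c *\<^sub>C cblinfun_apply f x"
  by transfer simp

definition Cblinfun ::
  "('a::complex_normed_vector \<Rightarrow> 'b::complex_normed_vector) \<Rightarrow> ('a \<Rightarrow>\<^sub>C\<^sub>L 'b)" where
  "Cblinfun f = Abs_cblinfun (Blinfun f)"

lemma cblinfun_apply_Cblinfun:
  assumes "bounded_linear f" and "\<And>c x. f (c *\<^sub>C x) = c *\<^sub>C f x"
  shows "cblinfun_apply (Cblinfun f) = f"
  using assms
  by (simp add: Cblinfun_def cblinfun_apply.rep_eq Abs_cblinfun_inverse bounded_linear_Blinfun_apply)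

instance cblinfun :: (complex_normed_vector, complex_banach) complex_banach
proof
  fix X :: "nat \<Rightarrow> ('a \<Rightarrow>\<^sub>C\<^sub>L 'b)"
  assume X: "Cauchy X"
  define Y where "Y n = blinfun_of_cblinfun (X n)" for n
  have "Cauchy Y"
    using X by (simp add: Cauchy_def Y_def dist_cblinfun.rep_eq)
  then obtain L where L: "Y \<longlonglongrightarrow> L"
    using Cauchy_convergent convergent_def by blast
  have L_apply: "(\<lambda>n. blinfun_apply (Y n) x) \<longlonglongrightarrow> blinfun_apply L x" for x
    using L by (intro blinfun.tendsto tendsto_const)
  have "blinfun_apply L (c *\<^sub>C x) = c *\<^sub>C blinfun_apply L x" for c x
  proof (rule LIMSEQ_unique)
    show "(\<lambda>n. blinfun_apply (Y n) (c *\<^sub>C x)) \<longlonglongrightarrow> blinfun_apply L (c *\<^sub>C x)"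
      by (rule L_apply)
    have "(\<lambda>n. c *\<^sub>C blinfun_apply (Y n) x) \<longlonglongrightarrow> c *\<^sub>C blinfun_apply L x"
      by (rule bounded_linear.tendsto[OF bounded_linear_scaleC L_apply])
    moreover have "blinfun_apply (Y n) (c *\<^sub>C x) = c *\<^sub>C blinfun_apply (Y n) x" for n
      using blinfun_of_cblinfun[of "X n"] by (simp add: Y_def)
    ultimately show "(\<lambda>n. blinfun_apply (Y n) (c *\<^sub>C x)) \<longlonglongrightarrow> c *\<^sub>C blinfun_apply L x"
      by simp
  qed
  then have "blinfun_of_cblinfun (Abs_cblinfun L) = L"
    by (intro Abs_cblinfun_inverse) simp
  with L have "X \<longlonglongrightarrow> Abs_cblinfun L"
    by (simp add: tendsto_iff Y_def dist_cblinfun.rep_eq)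
  then show "convergent X"
    by (rule convergentI)
qed


section \<open>Operators, spectra and Drazin spectra\<close>

lift_definition id_cblinfun :: "'a::complex_normed_vector \<Rightarrow>\<^sub>C\<^sub>L 'a" is id_blinfun
  by simp

lift_definition cblinfun_compose ::
  "('b::complex_normed_vector \<Rightarrow>\<^sub>C\<^sub>L 'c::complex_normed_vector) \<Rightarrow>
    ('a::complex_normed_vector \<Rightarrow>\<^sub>C\<^sub>L 'b) \<Rightarrow> ('a \<Rightarrow>\<^sub>C\<^sub>L 'c)" (infixl "o\<^sub>C\<^sub>L" 70)
  is blinfun_compose
  by simp

primrec cblinfun_power ::
  "('a::complex_normed_vector \<Rightarrow>\<^sub>C\<^sub>L 'a) \<Rightarrow> nat \<Rightarrow> ('a \<Rightarrow>\<^sub>C\<^sub>L 'a)" where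
  "cblinfun_power T 0 = id_cblinfun"
| "cblinfun_power T (Suc n) = T o\<^sub>C\<^sub>L cblinfun_power T n"

definition cblinfun_invertible :: "('a::complex_normed_vector \<Rightarrow>\<^sub>C\<^sub>L 'a) \<Rightarrow> bool" where
  "cblinfun_invertible T \<longleftrightarrow> (\<exists>S. T o\<^sub>C\<^sub>L S = id_cblinfun \<and> S o\<^sub>C\<^sub>L T = id_cblinfun)"

definition spectrum :: "('a::complex_banach \<Rightarrow>\<^sub>C\<^sub>L 'a) \<Rightarrow> complex set" where
  "spectrum T = {l. \<not> cblinfun_invertible (T - l *\<^sub>C id_cblinfun)}"

text \<open>
  The exponent may be \<open>0\<close>; this makes no difference, since the equations for \<open>m\<close> imply those
  for every larger exponent.
\<close>

definition drazin_invertible :: "('a::complex_banach \<Rightarrow>\<^sub>C\<^sub>L 'a) \<Rightarrow> bool" where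
  "drazin_invertible T \<longleftrightarrow>
    (\<exists>S m. cblinfun_power T m = cblinfun_power T m o\<^sub>C\<^sub>L S o\<^sub>C\<^sub>L T \<and>
           S o\<^sub>C\<^sub>L T o\<^sub>C\<^sub>L S = S \<and>
           T o\<^sub>C\<^sub>L S = S o\<^sub>C\<^sub>L T)"

definition drazin_spectrum :: "('a::complex_banach \<Rightarrow>\<^sub>C\<^sub>L 'a) \<Rightarrow> complex set" where
  "drazin_spectrum T = {l. \<not> drazin_invertible (T - l *\<^sub>C id_cblinfun)}"


section \<open>Generalized derivations\<close>

lemma cblinfun_compose_apply [simp]:
  "cblinfun_apply (f o\<^sub>C\<^sub>L g) x = cblinfun_apply f (cblinfun_apply g x)"
  by transfer simp

lemma bounded_bilinear_cblinfun_compose: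
  "bounded_bilinear ((o\<^sub>C\<^sub>L) :: ('b::complex_normed_vector \<Rightarrow>\<^sub>C\<^sub>L 'c::complex_normed_vector) \<Rightarrow>
    ('a::complex_normed_vector \<Rightarrow>\<^sub>C\<^sub>L 'b) \<Rightarrow> ('a \<Rightarrow>\<^sub>C\<^sub>L 'c))"
proof
  fix f f' :: "'b \<Rightarrow>\<^sub>C\<^sub>L 'c" and g g' :: "'a \<Rightarrow>\<^sub>C\<^sub>L 'b" and r :: real
  note simps = bounded_bilinear.add_left[OF bounded_bilinear_blinfun_compose]
    bounded_bilinear.add_right[OF bounded_bilinear_blinfun_compose]
    bounded_bilinear.scaleR_left[OF bounded_bilinear_blinfun_compose]
    bounded_bilinear.scaleR_right[OF bounded_bilinear_blinfun_compose]
  show "(f + f') o\<^sub>C\<^sub>L g = f o\<^sub>C\<^sub>L g + f' o\<^sub>C\<^sub>L g" by transfer (simp add: simps)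
  show "f o\<^sub>C\<^sub>L (g + g') = f o\<^sub>C\<^sub>L g + f o\<^sub>C\<^sub>L g'" by transfer (simp add: simps)
  show "(r *\<^sub>R f) o\<^sub>C\<^sub>L g = r *\<^sub>R (f o\<^sub>C\<^sub>L g)" by transfer (simp add: simps)
  show "f o\<^sub>C\<^sub>L (r *\<^sub>R g) = r *\<^sub>R (f o\<^sub>C\<^sub>L g)" by transfer (simp add: simps)
  have "norm (f o\<^sub>C\<^sub>L g) \<le> norm f * norm g * 1" for f :: "'b \<Rightarrow>\<^sub>C\<^sub>L 'c" and g :: "'a \<Rightarrow>\<^sub>C\<^sub>L 'b"
    by transfer (simp add: norm_blinfun_compose)
  then show "\<exists>K. \<forall>(f :: 'b \<Rightarrow>\<^sub>C\<^sub>L 'c) (g :: 'a \<Rightarrow>\<^sub>C\<^sub>L 'b). norm (f o\<^sub>C\<^sub>L g) \<le> norm f * norm g * K"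
    by blast
qed

definition generalized_derivation ::
  "('x::complex_normed_vector \<Rightarrow>\<^sub>C\<^sub>L 'x) \<Rightarrow> ('y::complex_normed_vector \<Rightarrow>\<^sub>C\<^sub>L 'y) \<Rightarrow>
    (('y \<Rightarrow>\<^sub>C\<^sub>L 'x) \<Rightarrow>\<^sub>C\<^sub>L ('y \<Rightarrow>\<^sub>C\<^sub>L 'x))" where
  "generalized_derivation A B = Cblinfun (\<lambda>U. A o\<^sub>C\<^sub>L U - U o\<^sub>C\<^sub>L B)"

lemma generalized_derivation_apply:
  "cblinfun_apply (generalized_derivation A B) U = A o\<^sub>C\<^sub>L U - U o\<^sub>C\<^sub>L B"
proof -
  have "bounded_linear (\<lambda>U. A o\<^sub>C\<^sub>L U - U o\<^sub>C\<^sub>L B)"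
    by (intro bounded_linear_sub
        bounded_bilinear.bounded_linear_left[OF bounded_bilinear_cblinfun_compose]
        bounded_bilinear.bounded_linear_right[OF bounded_bilinear_cblinfun_compose])
  moreover have "A o\<^sub>C\<^sub>L (c *\<^sub>C U) - (c *\<^sub>C U) o\<^sub>C\<^sub>L B = c *\<^sub>C (A o\<^sub>C\<^sub>L U - U o\<^sub>C\<^sub>L B)" for c U
  proof -
    have "A o\<^sub>C\<^sub>L (c *\<^sub>C U) = c *\<^sub>C (A o\<^sub>C\<^sub>L U)" "(c *\<^sub>C U) o\<^sub>C\<^sub>L B = c *\<^sub>C (U o\<^sub>C\<^sub>L B)"
      by (auto intro!: cblinfun_eqI simp: cblinfun_apply_scaleC_left cblinfun_apply_scaleC_right)
    then show ?thesis by (simp add: complex_vector.scale_right_diff_distrib)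
  qed
  ultimately show ?thesis
    by (simp add: generalized_derivation_def cblinfun_apply_Cblinfun)
qed


section \<open>Differences of sets\<close>

text \<open>For sets, the overloaded minus sign denotes relative complement.\<close>

definition pointwise_diff :: "complex set \<Rightarrow> complex set \<Rightarrow> complex set" where
  "pointwise_diff S T = {s - t | s t. s \<in> S \<and> t \<in> T}"

end

theory Submission
  imports Defs "HOL-Complex_Analysis.Cauchy_Integral_Formula"
begin

text \<open>
  Let \<open>L\<close> and \<open>R\<close> be left multiplication by \<open>A\<close> and right multiplication by \<open>B\<close>, so that
  \<open>\<rho> = L - R\<close> with \<open>L\<close> and \<open>R\<close> commuting. Shifting \<open>A\<close> and \<open>B\<close> by the same scalar \<open>\<mu>\<close> does not
  change \<open>\<rho>\<close>, so the theorem says that \<open>\<rho>\<close> is Drazin invertible iff for every \<open>\<mu>\<close> one of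
  \<open>A - \<mu>\<close>, \<open>B - \<mu>\<close> is invertible or both are Drazin invertible.

  If the condition on all \<open>\<mu>\<close> holds, put \<open>t = L - R\<close> and let \<open>J\<close> be the ideal of all \<open>y\<close> in the
  bicommutant of \<open>L\<close> and \<open>R\<close> such that \<open>t\<^sup>m y\<close> is a multiple of \<open>t\<^sup>m\<^sup>+\<^sup>1\<close>. Modulo \<open>J\<close>, the element
  \<open>L - \<mu>\<close> has a locally holomorphic inverse, built from the regular parts of the resolvents of
  \<open>L\<close> and \<open>R\<close>. A functional vanishing on \<open>J\<close> turns these local inverses into an entire function that
  vanishes at infinity, and Liouville's theorem shows that it annihilates \<open>1\<close>. Hence \<open>1\<close> is in the
  closure of \<open>J\<close>, so \<open>J\<close> contains an invertible element and \<open>t\<^sup>m\<close> is a multiple of \<open>t\<^sup>m\<^sup>+\<^sup>1\<close>. For \<open>m = 0\<close>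
  this is Rosenblum's theorem.

  Conversely, if \<open>\<rho>\<close> has Drazin inverse \<open>s\<close>, then \<open>L\<^sup>m = s L\<^sup>m\<^sup>+\<^sup>1 + w R\<close> with \<open>s\<close> and \<open>w\<close> commuting with
  \<open>L\<close> and \<open>R\<close>. If \<open>B\<close> is not invertible, there are functionals \<open>f\<close> and vectors \<open>y\<close> with \<open>f y = 1\<close>
  such that \<open>f \<circ> B = 0\<close> or \<open>B y\<close> is small; evaluating the identity at the rank one operators
  \<open>x \<otimes> f\<close> and at \<open>y\<close> removes the remainder in the limit. This shows that \<open>A\<close> is bounded below on the
  closure of the range of \<open>A\<^sup>m\<close> and maps it onto itself, so \<open>A\<close> is Drazin invertible. The roles of
  \<open>A\<close> and \<open>B\<close> can be exchanged.
\<close>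

section \<open>The Hahn--Banach theorem\<close>

definition sublinear :: "('a::real_vector \<Rightarrow> real) \<Rightarrow> bool" where
  "sublinear p \<longleftrightarrow> (\<forall>x y. p (x + y) \<le> p x + p y) \<and> (\<forall>t x. 0 \<le> t \<longrightarrow> p (t *\<^sub>R x) = t * p x)"

text \<open>Applying the inequality for positive scalars to \<open>inverse t\<close> and
  \<open>t *\<^sub>R x\<close> gives the reverse inequality, hence homogeneity.\<close>

lemma sublinearI:
  assumes "\<And>x y. p (x + y) \<le> p x + p y" and "\<And>t x. 0 < t \<Longrightarrow> p (t *\<^sub>R x) \<le> t * p x" and "p 0 = 0"
  shows "sublinear p"
proof -
  have "p (t *\<^sub>R x) = t * p x" if "0 \<le> t" for t x
  proof (cases "t = 0")
    case False
    with that have t: "0 < t" by simp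
    have "p (inverse t *\<^sub>R (t *\<^sub>R x)) \<le> inverse t * p (t *\<^sub>R x)"
      using t by (intro assms(2)) simp
    then have "t * p x \<le> p (t *\<^sub>R x)"
      using t by (simp add: field_simps)
    with assms(2)[OF t, of x] show ?thesis by simp
  qed (simp add: assms(3))
  with assms(1) show ?thesis by (simp add: sublinear_def)
qed

lemma sublinear_add: "sublinear p \<Longrightarrow> p (x + y) \<le> p x + p y"
  and sublinear_scaleR: "sublinear p \<Longrightarrow> 0 \<le> t \<Longrightarrow> p (t *\<^sub>R x) = t * p x"
  by (simp_all add: sublinear_def)

lemma sublinear_zero: "sublinear p \<Longrightarrow> p 0 = 0"
  using sublinear_scaleR[of p 0 0] by simp

lemma sublinear_minus: "sublinear p \<Longrightarrow> - p (- x) \<le> p x"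
  using sublinear_add[of p x "- x"] sublinear_zero[of p] by simp

text \<open>Take for \<open>q x\<close> the infimum of
  \<open>p (x + t *\<^sub>R y) - t * p y\<close> over \<open>t \<ge> 0\<close>. Every term is at
  least \<open>- p (- x)\<close>, so the infimum is finite, and \<open>t = 0\<close> and
  \<open>t = 1\<close> give the two bounds. Subadditivity follows by adding the parameters chosen
  for the two arguments.\<close>

lemma sublinear_shift:
  fixes y :: "'a::real_vector"
  assumes p: "sublinear p"
  obtains q where "sublinear q" "\<And>x. q x \<le> p x" "\<And>x. q x \<le> p (x + y) - p y"
proof
  define q where "q x = (INF t\<in>{0..}. p (x + t *\<^sub>R y) - t * p y)" for x
  have lower: "- p (- x) \<le> p (x + t *\<^sub>R y) - t * p y" if "0 \<le> t" for x t
    using sublinear_add[OF p, of "x + t *\<^sub>R y" "- x"] sublinear_scaleR[OF p that, of y] by simp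
  have bdd: "bdd_below ((\<lambda>t. p (x + t *\<^sub>R y) - t * p y) ` {0..})" for x
    by (rule bdd_belowI2[of _ "- p (- x)"]) (use lower in auto)
  have le: "q x \<le> p (x + t *\<^sub>R y) - t * p y" if "0 \<le> t" for x t
    unfolding q_def using bdd that by (intro cINF_lower) auto
  have greatest: "c \<le> q x" if "\<And>t. 0 \<le> t \<Longrightarrow> c \<le> p (x + t *\<^sub>R y) - t * p y" for c x
    unfolding q_def using that by (intro cINF_greatest) auto
  show "sublinear q"
  proof (rule sublinearI)
    fix x z :: 'a
    have "q (x + z) - (p (x + t *\<^sub>R y) - t * p y) \<le> q z" if t: "0 \<le> t" for t
    proof (rule greatest)
      fix s :: real assume s: "0 \<le> s"
      have "q (x + z) \<le> p ((x + z) + (t + s) *\<^sub>R y) - (t + s) * p y"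
        using s t by (intro le) simp
      also have "(x + z) + (t + s) *\<^sub>R y = (x + t *\<^sub>R y) + (z + s *\<^sub>R y)"
        by (simp add: scaleR_add_left)
      also have "p \<dots> \<le> p (x + t *\<^sub>R y) + p (z + s *\<^sub>R y)"
        by (rule sublinear_add[OF p])
      finally show "q (x + z) - (p (x + t *\<^sub>R y) - t * p y) \<le> p (z + s *\<^sub>R y) - s * p y"
        by (simp add: algebra_simps)
    qed
    then have "q (x + z) - q z \<le> q x"
      by (intro greatest) (simp add: algebra_simps)
    then show "q (x + z) \<le> q x + q z" by simp
  next
    fix c :: real and x :: 'a assume c: "0 < c"
    have "inverse c * q (c *\<^sub>R x) \<le> q x"
    proof (rule greatest)
      fix t :: real assume t: "0 \<le> t"
      have "q (c *\<^sub>R x) \<le> p (c *\<^sub>R x + (c * t) *\<^sub>R y) - (c * t) * p y"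
        using c t by (intro le) simp
      also have "c *\<^sub>R x + (c * t) *\<^sub>R y = c *\<^sub>R (x + t *\<^sub>R y)"
        by (simp add: scaleR_add_right)
      also have "p \<dots> = c * p (x + t *\<^sub>R y)"
        using c by (intro sublinear_scaleR[OF p]) simp
      finally show "inverse c * q (c *\<^sub>R x) \<le> p (x + t *\<^sub>R y) - t * p y"
        using c by (simp add: field_simps)
    qed
    then show "q (c *\<^sub>R x) \<le> c * q x"
      using c by (simp add: field_simps)
  next
    show "q 0 = 0"
    proof (rule antisym)
      show "q 0 \<le> 0" using le[of 0 0] sublinear_zero[OF p] by simp
      show "0 \<le> q 0"
        by (intro greatest) (simp add: sublinear_scaleR[OF p])
    qed
  qed
  show "q x \<le> p x" for x using le[of 0 x] by simp
  show "q x \<le> p (x + y) - p y" for x using le[of 1 x] by simp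
qed

text \<open>Zorn's lemma for the reversed pointwise order. A nonempty chain is bounded by its
  pointwise infimum, which is finite because \<open>- p (- x)\<close> lies below all
  members.\<close>

lemma minimal_sublinear_exists:
  fixes p :: "'a::real_vector \<Rightarrow> real"
  assumes p: "sublinear p"
  obtains q where "sublinear q" "q \<le> p" "\<And>q'. sublinear q' \<Longrightarrow> q' \<le> q \<Longrightarrow> q' = q"
proof -
  let ?A = "{q. sublinear q \<and> q \<le> p}"
  have "\<exists>m\<in>?A. \<forall>a\<in>?A. (\<lambda>q q'. q' \<le> q) m a \<longrightarrow> a = m"
  proof (rule predicate_Zorn)
    show "partial_order_on ?A (relation_of (\<lambda>q q'. q' \<le> q) ?A)"
      by (rule partial_order_on_relation_ofI) auto
  next
    fix C assume "C \<in> Chains (relation_of (\<lambda>q q' :: 'a \<Rightarrow> real. q' \<le> q) ?A)"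
    then have CA: "q \<in> ?A" if "q \<in> C" for q
      using that by (auto simp: Chains_def relation_of_def)
    have chain: "q \<le> q' \<or> q' \<le> q" if "q \<in> C" "q' \<in> C" for q q'
      using that \<open>C \<in> _\<close> by (auto simp: Chains_def relation_of_def)
    show "\<exists>u\<in>?A. \<forall>a\<in>C. u \<le> a"
    proof (cases "C = {}")
      case True
      with p show ?thesis by auto
    next
      case False
      define u where "u x = (INF q\<in>C. q x)" for x
      have bdd: "bdd_below ((\<lambda>q. q x) ` C)" for x
      proof (rule bdd_belowI2)
        fix q assume "q \<in> C"
        then have "sublinear q" "q (- x) \<le> p (- x)" using CA by (auto simp: le_fun_def)
        then show "- p (- x) \<le> q x" using sublinear_minus[of q x] by simp
      qed
      have le: "u x \<le> q x" if "q \<in> C" for q x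
        unfolding u_def using bdd that by (rule cINF_lower)
      have greatest: "c \<le> u x" if "\<And>q. q \<in> C \<Longrightarrow> c \<le> q x" for c x
        unfolding u_def using False that by (rule cINF_greatest)
      have "sublinear u"
      proof (rule sublinearI)
        fix x y
        have "u (x + y) - q x \<le> u y" if q: "q \<in> C" for q
        proof (rule greatest)
          fix q' assume q': "q' \<in> C"
          \<comment> \<open>The smaller of two chain members serves both arguments at once, which
            makes the infimum subadditive.\<close>
          from chain[OF q q'] obtain r where r: "r \<in> C" "r \<le> q" "r \<le> q'"
            using q q' by blast
          have "u (x + y) \<le> r (x + y)" by (rule le[OF r(1)])
          also have "\<dots> \<le> r x + r y" using CA[OF r(1)] by (simp add: sublinear_add)
          also have "\<dots> \<le> q x + q' y" using r(2,3) by (intro add_mono) (auto simp: le_fun_def)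
          finally show "u (x + y) - q x \<le> q' y" by simp
        qed
        then have "u (x + y) - u y \<le> u x"
          by (intro greatest) (simp add: algebra_simps)
        then show "u (x + y) \<le> u x + u y" by simp
      next
        fix t :: real and x assume t: "0 < t"
        have "inverse t * u (t *\<^sub>R x) \<le> u x"
        proof (rule greatest)
          fix q assume q: "q \<in> C"
          have "u (t *\<^sub>R x) \<le> q (t *\<^sub>R x)" by (rule le[OF q])
          also have "\<dots> = t * q x" using CA[OF q] t by (simp add: sublinear_scaleR)
          finally show "inverse t * u (t *\<^sub>R x) \<le> q x" using t by (simp add: field_simps)
        qed
        then show "u (t *\<^sub>R x) \<le> t * u x" using t by (simp add: field_simps)
      next
        have "(\<lambda>q. q 0) ` C = {0}" using False CA by (auto simp: sublinear_zero)
        then show "u 0 = 0" by (simp add: u_def)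
      qed
      moreover have "u \<le> p"
      proof -
        from False obtain q where q: "q \<in> C" by blast
        then have "u \<le> q" by (auto intro: le_funI le)
        also have "q \<le> p" using CA[OF q] by simp
        finally show ?thesis .
      qed
      ultimately show ?thesis by (auto intro!: bexI[of _ u] le_funI le)
    qed
  qed
  then obtain q where q: "sublinear q" "q \<le> p"
    and min: "\<And>q'. sublinear q' \<Longrightarrow> q' \<le> p \<Longrightarrow> q' \<le> q \<Longrightarrow> q' = q"
    by blast
  show thesis
    by (rule that[OF q]) (meson min order_trans q(2))
qed

text \<open>
  A minimal sublinear functional is linear, because replacing \<open>q x\<close> by
  \<open>inf t \<ge> 0. q (x + t y) - t q y\<close> can only make it smaller.
\<close>

theorem Hahn_Banach_sublinear:
  fixes p :: "'a::real_vector \<Rightarrow> real"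
  assumes p: "sublinear p"
  obtains f where "linear f" "\<And>x. f x \<le> p x" "f z = p z"
proof -
  \<comment> \<open>Shifting at \<open>z\<close> first gives \<open>p' (- z) \<le> - p z\<close>. A
    linear \<open>f\<close> below \<open>p'\<close> then satisfies \<open>p z \<le> f z\<close>, the
    half of \<open>f z = p z\<close> that domination by \<open>p\<close> does not give.\<close>
  obtain p' where p': "sublinear p'" "\<And>x. p' x \<le> p x" "\<And>x. p' x \<le> p (x + z) - p z"
    using sublinear_shift[OF p] by blast
  obtain f where f: "sublinear f" "f \<le> p'" and minimal: "\<And>q. sublinear q \<Longrightarrow> q \<le> f \<Longrightarrow> q = f"
    using minimal_sublinear_exists[OF p'(1)] by blast
  have add: "f (x + y) = f x + f y" for x y
  proof (rule antisym)
    obtain q where q: "sublinear q" "\<And>x. q x \<le> f x" "\<And>x. q x \<le> f (x + y) - f y"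
      using sublinear_shift[OF f(1)] by blast
    then have "q = f" by (intro minimal) (auto simp: le_fun_def)
    with q(3)[of x] show "f x + f y \<le> f (x + y)" by simp
  qed (rule sublinear_add[OF f(1)])
  have uminus: "f (- x) = - f x" for x
    using add[of x "- x"] sublinear_zero[OF f(1)] by simp
  have scale: "f (t *\<^sub>R x) = t * f x" for t x
  proof (cases "0 \<le> t")
    case False
    then have "f ((- t) *\<^sub>R x) = - t * f x" by (intro sublinear_scaleR[OF f(1)]) simp
    with uminus[of "t *\<^sub>R x"] show ?thesis by simp
  qed (rule sublinear_scaleR[OF f(1)])
  show thesis
  proof
    show "linear f" by (rule linearI) (simp_all add: add scale)
    show le: "f x \<le> p x" for x using f(2) p'(2)[of x] by (meson le_funD order_trans)
    have "f (- z) \<le> p 0 - p z" using f(2) p'(3)[of "- z"] by (metis le_funD order_trans add.left_inverse)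
    then show "f z = p z" using le[of z] uminus[of z] sublinear_zero[OF p] by simp
  qed
qed

section \<open>Separation of a point from a complex subspace\<close>

lemma sublinear_infdist:
  fixes M :: "'a::real_normed_vector set"
  assumes M: "subspace M"
  shows "sublinear (\<lambda>x. infdist x M)"
proof (rule sublinearI)
  have M0: "M \<noteq> {}" using subspace_0[OF M] by blast
  \<comment> \<open>The infimum need not be attained, so the estimates use near-minimisers in
    \<open>M\<close> and lose an arbitrary \<open>e\<close>.\<close>
  have approx: "\<exists>m\<in>M. dist x m < infdist x M + e" if "0 < e" for x and e :: real
    using cInf_lessD[of "dist x ` M" "infdist x M + e"] M0 that
    by (auto simp: infdist_notempty)
  show "infdist (x + y) M \<le> infdist x M + infdist y M" for x y
  proof (rule field_le_epsilon)
    fix e :: real assume "0 < e"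
    then obtain m n where m: "m \<in> M" "dist x m < infdist x M + e / 2"
      and n: "n \<in> M" "dist y n < infdist y M + e / 2"
      using approx[of "e / 2"] by (meson half_gt_zero)
    have "infdist (x + y) M \<le> dist (x + y) (m + n)"
      by (rule infdist_le) (simp add: subspace_add[OF M m(1) n(1)])
    also have "\<dots> \<le> dist x m + dist y n" by (rule dist_triangle_add)
    finally show "infdist (x + y) M \<le> infdist x M + infdist y M + e" using m n by simp
  qed
  show "infdist (t *\<^sub>R x) M \<le> t * infdist x M" if t: "0 < t" for t x
  proof (rule field_le_epsilon)
    fix e :: real assume "0 < e"
    then obtain m where m: "m \<in> M" "dist x m < infdist x M + e / t"
      using approx[of "e / t"] t by auto
    have "infdist (t *\<^sub>R x) M \<le> dist (t *\<^sub>R x) (t *\<^sub>R m)"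
      by (rule infdist_le) (simp add: subspace_scale[OF M m(1)])
    also have "\<dots> = t * dist x m"
      using t by (simp add: dist_norm flip: scaleR_diff_right)
    also have "\<dots> \<le> t * (infdist x M + e / t)" using m(2) t by (intro mult_left_mono) auto
    also have "\<dots> = t * infdist x M + e" using t by (simp add: field_simps)
    finally show "infdist (t *\<^sub>R x) M \<le> t * infdist x M + e" .
  qed
  show "infdist 0 M = 0" using subspace_0[OF M] by simp
qed

lemma scaleC_minus1: "(- 1) *\<^sub>C x = - (x :: 'a::complex_normed_vector)"
  by (simp add: complex_vector.scale_minus_left scaleC_one)

definition bounded_clinear :: "('a::complex_normed_vector \<Rightarrow> complex) \<Rightarrow> bool" where
  "bounded_clinear f \<longleftrightarrow> bounded_linear f \<and> (\<forall>c x. f (c *\<^sub>C x) = c * f x)"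

lemma complex_subspace_imp_subspace: "complex_vector.subspace M \<Longrightarrow> subspace M"
  by (simp add: complex_vector.subspace_def real_vector.subspace_def scaleR_scaleC)

text \<open>A real functional \<open>L\<close> dominated by the distance to \<open>M\<close>
  vanishes on \<open>M\<close> and can be made equal to that distance at \<open>z\<close>. Its
  complexification, with imaginary part \<open>- L (\<i> *\<^sub>C x)\<close>, still vanishes on
  \<open>M\<close>, and its modulus at \<open>z\<close> is at least the distance; dividing by this
  value gives \<open>f\<close>. The factor 2 comes from estimating real and imaginary parts
  separately.\<close>

theorem Hahn_Banach_separation:
  fixes M :: "'a::complex_normed_vector set"
  assumes M: "complex_vector.subspace M" and z: "z \<notin> closure M"
  obtains f where "bounded_clinear f" "\<And>m. m \<in> M \<Longrightarrow> f m = 0" "f z = 1"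
    "\<And>x. norm (f x) \<le> 2 / infdist z M * norm x"
proof -
  have RM: "subspace M" using M by (rule complex_subspace_imp_subspace)
  have M0: "M \<noteq> {}" using subspace_0[OF RM] by blast
  define d where "d = infdist z M"
  have d: "0 < d"
    using z in_closure_iff_infdist_zero[OF M0, of z] infdist_nonneg[of z M] by (auto simp: d_def)
  obtain L where L: "linear L" "\<And>x. L x \<le> infdist x M" "L z = d"
    unfolding d_def using Hahn_Banach_sublinear[OF sublinear_infdist[OF RM]] by blast
  have abs_L: "\<bar>L x\<bar> \<le> norm x" for x
  proof -
    have "infdist y M \<le> norm y" for y using infdist_le[OF subspace_0[OF RM], of y] by simp
    then show ?thesis
      using L(2)[of x] L(2)[of "- x"] linear_neg[OF L(1), of x] by (smt (verit) norm_minus_cancel)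
  qed
  have L_M: "L m = 0" if "m \<in> M" for m
    using L(2)[of m] L(2)[of "- m"] linear_neg[OF L(1), of m] that subspace_neg[OF RM that] by simp
  define g where "g x = Complex (L x) (- L (\<i> *\<^sub>C x))" for x
  have g_add: "g (x + y) = g x + g y" for x y
    by (simp add: g_def complex_eq_iff linear_add[OF L(1)] scaleC_add_right)
  have g_scaleR: "g (r *\<^sub>R x) = r *\<^sub>R g x" for r x
  proof -
    have "\<i> *\<^sub>C r *\<^sub>R x = r *\<^sub>R \<i> *\<^sub>C x" by (simp add: scaleR_scaleC scaleC_scaleC mult.commute)
    then show ?thesis by (simp add: g_def complex_eq_iff linear_scale[OF L(1)])
  qed
  have g_i: "g (\<i> *\<^sub>C x) = \<i> * g x" for x
    by (simp add: g_def complex_eq_iff scaleC_scaleC scaleC_minus1 linear_neg[OF L(1)])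
  have g_scaleC: "g (c *\<^sub>C x) = c * g x" for c x
  proof -
    have "c *\<^sub>C x = Re c *\<^sub>R x + Im c *\<^sub>R (\<i> *\<^sub>C x)"
      by (simp add: scaleR_scaleC scaleC_scaleC flip: scaleC_add_left) (simp add: complex_eq mult.commute)
    then have "g (c *\<^sub>C x) = (complex_of_real (Re c) + \<i> * Im c) * g x"
      by (simp add: g_add g_scaleR g_i scaleR_conv_of_real algebra_simps)
    then show ?thesis by (simp flip: complex_eq)
  qed
  have g_norm: "cmod (g x) \<le> 2 * norm x" for x
  proof -
    have "cmod (g x) \<le> \<bar>L x\<bar> + \<bar>L (\<i> *\<^sub>C x)\<bar>"
      using cmod_le[of "g x"] by (simp add: g_def)
    also have "\<dots> \<le> norm x + norm (\<i> *\<^sub>C x)" by (intro add_mono abs_L)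
    finally show ?thesis by (simp add: norm_scaleC)
  qed
  have gz: "d \<le> cmod (g z)"
    using abs_Re_le_cmod[of "g z"] by (simp add: g_def L(3))
  define f where "f x = g x / g z" for x
  have bound: "cmod (f x) \<le> 2 / d * norm x" for x
  proof -
    have "cmod (f x) \<le> (2 * norm x) / d"
      unfolding f_def norm_divide using g_norm gz d by (intro frac_le) auto
    then show ?thesis by simp
  qed
  have "bounded_linear f"
    by (rule bounded_linear_intro[where K = "2 / d"])
      (use bound in \<open>simp_all add: f_def g_add g_scaleR add_divide_distrib scaleR_conv_of_real mult.commute\<close>)
  then have "bounded_clinear f"
    by (simp add: bounded_clinear_def f_def g_scaleC)
  moreover have "f m = 0" if "m \<in> M" for m
    using that complex_vector.subspace_scale[OF M that, of \<i>]
    by (simp add: f_def g_def L_M flip: zero_complex.code)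
  moreover have "f z = 1" using gz d by (auto simp: f_def)
  ultimately show thesis using bound that unfolding d_def by blast
qed

corollary norming_functional:
  fixes z :: "'a::complex_normed_vector"
  assumes "z \<noteq> 0"
  obtains f where "bounded_clinear f" "f z = 1" "\<And>x. norm (f x) \<le> 2 / norm z * norm x"
proof -
  have "z \<notin> closure {0}" using assms by simp
  then show thesis
    using Hahn_Banach_separation[of "{0}" z] that by (auto simp: complex_vector.subspace_def dist_norm)
qed


section \<open>Drazin inverses in monoids and rings\<close>

text \<open>Keeping the exponent as a parameter lets \<open>m = 0\<close> express ordinary
  invertibility.\<close>

definition is_drazin_inverse :: "nat \<Rightarrow> 'a::monoid_mult \<Rightarrow> 'a \<Rightarrow> bool" where
  "is_drazin_inverse m t s \<longleftrightarrow> t ^ m = t ^ m * s * t \<and> s * t * s = s \<and> t * s = s * t"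

text \<open>The idempotent \<open>e = s * t\<close> equals both \<open>s ^ n * e * t ^ n\<close> and
  \<open>t ^ n * e * s ^ n\<close>. For \<open>n = m\<close> the power \<open>t ^ m\<close> commutes
  with \<open>d\<close> and absorbs \<open>e\<close> on either side, whence
  \<open>e * d = e * d * e = d * e\<close>. Then
  \<open>s * d = s * d * t * s = e * d * s = d * s\<close>.\<close>

lemma is_drazin_inverse_commute:
  assumes "is_drazin_inverse m t s" and dt: "d * t = t * d"
  shows "d * s = s * d"
proof -
  have tm: "t ^ m = t ^ m * s * t" and sts: "s * t * s = s" and ts: "t * s = s * t"
    using assms(1) by (auto simp: is_drazin_inverse_def)
  define e where "e = s * t"
  have e': "e = t * s" by (simp add: e_def ts)
  have e1: "t ^ m * e = t ^ m" using tm by (simp add: e_def mult.assoc)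
  have te: "t * e = e * t" by (metis e_def e' mult.assoc)
  have e2: "e * t ^ m = t ^ m" using e1 power_commuting_commutes[OF te] by simp
  have se: "s * e = s" "e * s = s" using sts by (simp_all add: e_def ts mult.assoc)
  have dtm: "d * t ^ m = t ^ m * d" using power_commuting_commutes[OF dt[symmetric]] by simp
  have p1: "s ^ n * e * t ^ n = e" for n
  proof (induction n)
    case (Suc n)
    have "s ^ Suc n * e * t ^ Suc n = s ^ n * (s * e * t) * t ^ n"
      by (simp add: power_Suc2[of s] mult.assoc del: power_Suc) (simp add: mult.assoc)
    also have "s * e * t = e" by (simp only: se(1)) (simp only: e_def)
    finally show ?case using Suc.IH by simp
  qed simp
  have p2: "t ^ n * e * s ^ n = e" for n
  proof (induction n)
    case (Suc n)
    have "t ^ Suc n * e * s ^ Suc n = t ^ n * (t * e * s) * s ^ n"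
      by (simp add: power_Suc2[of t] mult.assoc del: power_Suc) (simp add: mult.assoc)
    also have "t * e * s = e" by (simp only: mult.assoc se(2)) (simp only: e')
    finally show ?case using Suc.IH by simp
  qed simp
  have "e * d = s ^ m * e * (t ^ m * d)" by (metis p1 mult.assoc)
  also have "\<dots> = s ^ m * e * (d * t ^ m)" by (simp add: dtm)
  also have "\<dots> = s ^ m * e * (d * t ^ m) * e" by (simp add: mult.assoc e1)
  also have "\<dots> = e * d * e" by (metis p1 dtm mult.assoc)
  finally have ed: "e * d = e * d * e" .
  have "d * e = d * t ^ m * e * s ^ m" by (metis p2 mult.assoc)
  also have "\<dots> = t ^ m * d * e * s ^ m" by (simp add: dtm)
  also have "\<dots> = e * (t ^ m * d * e * s ^ m)" by (simp add: e2 flip: mult.assoc)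
  also have "\<dots> = e * (d * t ^ m * e * s ^ m)" by (simp add: dtm)
  also have "\<dots> = e * d * e" by (metis p2 mult.assoc)
  finally have de: "e * d = d * e" using ed by simp
  have "s * d = s * (e * d)" by (simp add: se flip: mult.assoc)
  also have "\<dots> = s * (d * t) * s" by (simp only: de) (simp only: e' mult.assoc)
  also have "\<dots> = (e * d) * s" by (simp add: dt e_def mult.assoc)
  also have "\<dots> = d * s" by (simp add: de mult.assoc se)
  finally show ?thesis by simp
qed

text \<open>The hypothesis says that \<open>t ^ m\<close> absorbs \<open>t * w\<close>, hence all
  its powers. The candidate inverse multiplied by \<open>t\<close> is
  \<open>(t * w) ^ Suc m\<close>, so the defining equations reduce to this absorption.\<close>

lemma is_drazin_inverse_strongly_pi_regular:
  assumes tm: "t ^ m = t ^ Suc m * w" and tw: "t * w = w * t"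
  shows "is_drazin_inverse m t (t ^ m * w ^ Suc m)"
proof -
  have tmw: "t ^ m * t * w = t ^ m" using tm by (metis power_Suc2)
  have absorb: "t ^ m * (t * w) ^ k = t ^ m" for k
  proof (induction k)
    case (Suc k)
    have "t ^ m * (t * w) ^ Suc k = (t ^ m * t) * w * (t * w) ^ k" by (simp add: mult.assoc)
    then show ?case by (simp only: tmw Suc.IH)
  qed simp
  have tw': "(t * w) ^ k = t ^ k * w ^ k" for k
  proof (induction k)
    case (Suc k)
    have "w * t ^ k = t ^ k * w" using power_commuting_commutes[OF tw] by simp
    then show ?case by (simp add: Suc.IH) (metis mult.assoc)
  qed simp
  have wt: "w ^ k * t = t * w ^ k" for k
    using power_commuting_commutes[OF tw[symmetric]] by simp
  have wt': "w ^ k * t ^ l = t ^ l * w ^ k" for k l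
    using power_commuting_commutes[OF wt[of k, symmetric], of l] by simp
  let ?s = "t ^ m * w ^ Suc m"
  have st: "?s * t = (t * w) ^ Suc m"
    unfolding tw' using wt[of "Suc m"] by (metis mult.assoc power_Suc2)
  show ?thesis
    unfolding is_drazin_inverse_def
  proof (intro conjI)
    show "t ^ m = t ^ m * ?s * t" by (metis mult.assoc st absorb)
    have "?s * t * ?s = (t * w) ^ Suc m * t ^ m * w ^ Suc m" unfolding st by (rule mult.assoc[symmetric])
    also have "(t * w) ^ Suc m * t ^ m = t ^ m * (t * w) ^ Suc m"
      unfolding tw' by (metis wt' power_add add.commute mult.assoc)
    finally show "?s * t * ?s = ?s" by (simp only: absorb)
    show "t * ?s = ?s * t" by (metis wt mult.assoc power_commutes)
  qed
qed

lemma is_drazin_inverse_0_iff: "is_drazin_inverse 0 t s \<longleftrightarrow> t * s = 1 \<and> s * t = 1"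
  by (auto simp: is_drazin_inverse_def)

lemma is_drazin_inverse_uminus:
  fixes t :: "'a::{ring,monoid_mult}"
  assumes "is_drazin_inverse m t s" shows "is_drazin_inverse m (- t) (- s)"
proof -
  have "(- t) ^ m = t ^ m \<or> (- t) ^ m = - (t ^ m)"
    by (induction m) auto
  with assms show ?thesis by (auto simp: is_drazin_inverse_def)
qed

text \<open>In the binomial expansion every term contains \<open>x ^ i\<close> or
  \<open>y ^ j\<close>. The induction avoids binomial coefficients by splitting off one factor
  \<open>x - y\<close> and passing from \<open>q\<close> to \<open>x * q\<close> and
  \<open>y * q\<close>.\<close>

lemma power_diff_mult_eq_0:
  fixes x y q :: "'a::{ring,monoid_mult}"
  assumes "x * y = y * x" "x ^ i * q = 0" "y ^ j * q = 0"
  shows "(x - y) ^ (i + j) * q = 0"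
  using assms
proof (induction "i + j" arbitrary: i j q)
  case (Suc n)
  show ?case
  proof (cases "i = 0 \<or> j = 0")
    case True
    with Suc.prems show ?thesis by auto
  next
    case False
    then obtain i' j' where ij: "i = Suc i'" "j = Suc j'" by (meson not0_implies_Suc)
    have xy: "x ^ k * y = y * x ^ k" "y ^ k * x = x * y ^ k" for k
      using power_commuting_commutes[of x y k] power_commuting_commutes[of y x k] Suc.prems(1) by simp_all
    have "(x - y) ^ (i' + j) * (x * q) = 0"
    proof (rule Suc.hyps(1))
      show "x ^ i' * (x * q) = 0" using Suc.prems(2) by (simp add: ij power_Suc2 mult.assoc del: power_Suc)
      show "y ^ j * (x * q) = 0" using Suc.prems(3) xy by (simp flip: mult.assoc) (simp add: mult.assoc)
    qed (use Suc ij in auto)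
    moreover have "(x - y) ^ (i + j') * (y * q) = 0"
    proof (rule Suc.hyps(1))
      show "y ^ j' * (y * q) = 0" using Suc.prems(3) by (simp add: ij power_Suc2 mult.assoc del: power_Suc)
      show "x ^ i * (y * q) = 0" using Suc.prems(2) xy by (simp flip: mult.assoc) (simp add: mult.assoc)
    qed (use Suc ij in auto)
    moreover have "i + j = Suc (i' + j)" "i + j' = i' + j" using ij by auto
    moreover have "(x - y) ^ Suc k * q = (x - y) ^ k * (x * q) - (x - y) ^ k * (y * q)" for k
      unfolding power_Suc2 by (simp add: mult.assoc left_diff_distrib right_diff_distrib)
    ultimately show ?thesis by simp
  qed
qed auto

lemma is_drazin_inverse_imp_generates:
  assumes "is_drazin_inverse m t s" shows "t ^ m = s * t ^ Suc m"
proof -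
  have "t ^ m = t ^ m * s * t" "t * s = s * t" using assms by (auto simp: is_drazin_inverse_def)
  then show ?thesis
    using power_commuting_commutes[of t s m] by (simp add: mult.assoc power_commutes)
qed

lemma commuting_difference_power:
  fixes l r :: "'a::{ring,monoid_mult}"
  assumes lr: "l * r = r * l"
  obtains q where "(l - r) ^ n = l ^ n + q * r" "q * r = r * q"
proof -
  have "\<exists>q. (l - r) ^ n = l ^ n + q * r \<and> q * r = r * q"
  proof (induction n)
    case 0
    show ?case by (intro exI[of _ 0]) simp
  next
    case (Suc n)
    then obtain q where q: "(l - r) ^ n = l ^ n + q * r" "q * r = r * q" by blast
    have rl: "r * l ^ n = l ^ n * r" using power_commuting_commutes[OF lr] by simp
    let ?q = "l * q - r * q - l ^ n"
    have "(l - r) ^ Suc n = l ^ Suc n + ?q * r"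
      by (simp add: q(1) distrib_left left_diff_distrib mult.assoc rl)
    moreover have "?q * r = r * ?q"
    proof -
      have "l * q * r = r * (l * q)" using lr q(2) by (metis mult.assoc)
      moreover have "r * q * r = r * (r * q)" using q(2) by (simp add: mult.assoc)
      ultimately show ?thesis by (simp only: left_diff_distrib right_diff_distrib rl)
    qed
    ultimately show ?case by blast
  qed
  with that show thesis by blast
qed

text \<open>Expand both sides of \<open>t ^ m = s * t ^ Suc m\<close> for \<open>t = l - r\<close>
  and collect all terms divisible by \<open>r\<close> in \<open>w * r\<close>. The commutation
  relations later allow \<open>r\<close> to act first or last.\<close>

lemma drazin_difference_remainder:
  fixes l r s :: "'a::{ring,monoid_mult}"
  assumes lr: "l * r = r * l" and s: "is_drazin_inverse m (l - r) s"
  obtains w where "l ^ m = s * l ^ Suc m + w * r" "w * r = r * w" "s * l = l * s" "s * r = r * s"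
proof -
  have "l * (l - r) = (l - r) * l" "r * (l - r) = (l - r) * r"
    by (simp_all add: left_diff_distrib right_diff_distrib lr)
  then have sl: "s * l = l * s" and sr: "s * r = r * s"
    using is_drazin_inverse_commute[OF s] by simp_all
  obtain p where p: "(l - r) ^ m = l ^ m + p * r" "p * r = r * p"
    using commuting_difference_power[OF lr] by blast
  obtain q where q: "(l - r) ^ Suc m = l ^ Suc m + q * r" "q * r = r * q"
    using commuting_difference_power[OF lr] by blast
  have "l ^ m + p * r = s * l ^ Suc m + s * q * r"
    using is_drazin_inverse_imp_generates[OF s] unfolding p(1) q(1) by (simp only: distrib_left mult.assoc)
  then have "l ^ m = s * l ^ Suc m + (s * q - p) * r"
    unfolding left_diff_distrib by (metis add_diff_eq add_diff_cancel_right')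
  moreover have "s * q * r = r * (s * q)" using sr q(2) by (metis mult.assoc)
  then have "(s * q - p) * r = r * (s * q - p)"
    by (simp only: left_diff_distrib right_diff_distrib p(2))
  ultimately show thesis using that sl sr by blast
qed

text \<open>The idempotent \<open>1 - x * s\<close> projects onto the nilpotent part of
  \<open>x\<close>.\<close>

lemma drazin_inverse_annihilator:
  fixes x s :: "'a::{ring,monoid_mult}"
  assumes "is_drazin_inverse m x s" shows "x ^ m * (1 - x * s) = 0"
  using assms by (simp add: is_drazin_inverse_def right_diff_distrib mult.assoc)

section \<open>Complex Banach algebras\<close>

text \<open>The unit comes from \<open>monoid_mult\<close>, so that operators on the zero space,
  where \<open>1 = 0\<close>, form an instance as well.\<close>

class cbanach_algebra = real_normed_algebra + complex_banach + monoid_mult +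
  assumes scaleC_mult_left: "(c *\<^sub>C x) * y = c *\<^sub>C (x * y)"
    and scaleC_mult_right: "x * (c *\<^sub>C y) = c *\<^sub>C (x * y)"

lemma power_scaleC: "(c *\<^sub>C x) ^ n = c ^ n *\<^sub>C (x :: 'a::cbanach_algebra) ^ n"
  by (induction n) (simp_all add: scaleC_one scaleC_mult_left scaleC_mult_right scaleC_scaleC mult.commute)

section \<open>Neumann series\<close>

definition neumann :: "'a::cbanach_algebra \<Rightarrow> 'a" where
  "neumann x = (\<Sum>n. x ^ n)"

context
  fixes x :: "'a::cbanach_algebra"
  assumes x: "norm x < 1"
begin

lemma summable_neumann: "summable (\<lambda>n. x ^ n)"
proof (rule summable_comparison_test)
  have "norm (x ^ n) \<le> (norm (1 :: 'a) + 1) * norm x ^ n" for n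
  proof (induction n)
    case (Suc n)
    have "norm (x ^ Suc n) \<le> norm x * norm (x ^ n)" by (simp add: norm_mult_ineq)
    also have "\<dots> \<le> norm x * ((norm (1 :: 'a) + 1) * norm x ^ n)" by (intro mult_left_mono Suc.IH) simp
    finally show ?case by (simp add: mult_ac)
  qed simp
  then show "\<exists>N. \<forall>n\<ge>N. norm (x ^ n) \<le> (norm (1 :: 'a) + 1) * norm x ^ n" by blast
  show "summable (\<lambda>n. (norm (1 :: 'a) + 1) * norm x ^ n)"
    using x by (intro summable_mult summable_geometric) simp
qed

lemma neumann_sums: "(\<lambda>n. x ^ n) sums neumann x"
  unfolding neumann_def by (rule summable_sums[OF summable_neumann])

lemma neumann_unfold: "neumann x = 1 + x * neumann x"
  using suminf_split_head[OF summable_neumann] suminf_mult[OF summable_neumann, of x]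
  by (simp add: neumann_def)

lemma neumann_commute:
  assumes "y * x = x * y" shows "y * neumann x = neumann x * y"
proof -
  have "y * x ^ n = x ^ n * y" for n using power_commuting_commutes[OF assms[symmetric]] by simp
  then show ?thesis
    unfolding neumann_def by (simp add: suminf_mult[OF summable_neumann, symmetric] suminf_mult2[OF summable_neumann])
qed

lemma neumann_inverse: "(1 - x) * neumann x = 1" "neumann x * (1 - x) = 1"
  using neumann_unfold neumann_commute[of x]
  by (simp_all add: left_diff_distrib right_diff_distrib diff_eq_eq)

lemma norm_neumann_le: "norm (neumann x) \<le> norm (1 :: 'a) / (1 - norm x)"
proof -
  have "norm (neumann x) \<le> norm (1 :: 'a) + norm (x * neumann x)"
    by (metis neumann_unfold norm_triangle_ineq)
  also have "\<dots> \<le> norm (1 :: 'a) + norm x * norm (neumann x)" by (simp add: norm_mult_ineq)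
  finally show ?thesis using x by (simp add: field_simps)
qed

end

section \<open>Bicommutants\<close>

definition bicommutant :: "'a::monoid_mult set \<Rightarrow> 'a set" where
  "bicommutant X = {c. \<forall>d. (\<forall>x\<in>X. d * x = x * d) \<longrightarrow> d * c = c * d}"

lemma bicommutantI: "(\<And>d. (\<And>x. x \<in> X \<Longrightarrow> d * x = x * d) \<Longrightarrow> d * c = c * d) \<Longrightarrow> c \<in> bicommutant X"
  and bicommutantD: "c \<in> bicommutant X \<Longrightarrow> (\<And>x. x \<in> X \<Longrightarrow> d * x = x * d) \<Longrightarrow> d * c = c * d"
  by (auto simp: bicommutant_def)

lemma bicommutant_superset: "x \<in> X \<Longrightarrow> x \<in> bicommutant X"
  by (simp add: bicommutant_def)

lemma bicommutant_1: "1 \<in> bicommutant X"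
  by (simp add: bicommutant_def)

lemma bicommutant_mult:
  assumes "c \<in> bicommutant X" "c' \<in> bicommutant X" shows "c * c' \<in> bicommutant X"
proof (rule bicommutantI)
  fix d assume "\<And>x. x \<in> X \<Longrightarrow> d * x = x * d"
  then have "d * c = c * d" "d * c' = c' * d"
    using bicommutantD[OF assms(1), of d] bicommutantD[OF assms(2), of d] by blast+
  then show "d * (c * c') = c * c' * d" by (metis mult.assoc)
qed

text \<open>A Drazin inverse commutes with everything that \<open>c\<close> commutes with, so
  inverses formed from the generators stay in the bicommutant.\<close>

lemma bicommutant_drazin_inverse:
  "c \<in> bicommutant X \<Longrightarrow> is_drazin_inverse m c s \<Longrightarrow> s \<in> bicommutant X"
  by (meson bicommutantI bicommutantD is_drazin_inverse_commute)

lemma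
  fixes c :: "'a::cbanach_algebra"
  assumes "c \<in> bicommutant X"
  shows bicommutant_scaleC: "k *\<^sub>C c \<in> bicommutant X"
    and bicommutant_neumann: "norm c < 1 \<Longrightarrow> neumann c \<in> bicommutant X"
    and bicommutant_add: "c' \<in> bicommutant X \<Longrightarrow> c + c' \<in> bicommutant X"
    and bicommutant_diff: "c' \<in> bicommutant X \<Longrightarrow> c - c' \<in> bicommutant X"
  using assms
  by (auto simp: bicommutant_def scaleC_mult_left scaleC_mult_right neumann_commute
      left_diff_distrib right_diff_distrib distrib_left distrib_right)

text \<open>Holomorphy is tested through functionals because Liouville's theorem is only applied
  after composing with one.\<close>

definition weakly_holomorphic_on ::
  "(complex \<Rightarrow> 'a::complex_normed_vector) \<Rightarrow> complex set \<Rightarrow> bool" (infix "weakly'_holomorphic'_on" 50) where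
  "G weakly_holomorphic_on U \<longleftrightarrow> (\<forall>\<phi>. bounded_clinear \<phi> \<longrightarrow> (\<lambda>z. \<phi> (G z)) holomorphic_on U)"

lemma weakly_holomorphic_on_add:
  "F weakly_holomorphic_on U \<Longrightarrow> G weakly_holomorphic_on U \<Longrightarrow> (\<lambda>z. F z + G z) weakly_holomorphic_on U"
  unfolding weakly_holomorphic_on_def bounded_clinear_def
  by (auto simp: linear_add[OF bounded_linear.linear] intro!: holomorphic_on_add)

lemma weakly_holomorphic_on_subset:
  "G weakly_holomorphic_on U \<Longrightarrow> V \<subseteq> U \<Longrightarrow> G weakly_holomorphic_on V"
  unfolding weakly_holomorphic_on_def using holomorphic_on_subset by blast

text \<open>Applying a functional term by term turns the Neumann series into a scalar power series
  about \<open>\<mu>\<close>.\<close>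

lemma weakly_holomorphic_neumann:
  fixes s c :: "'a::cbanach_algebra"
  assumes small: "\<And>z. z \<in> ball \<mu> r \<Longrightarrow> norm ((z - \<mu>) *\<^sub>C s) < 1"
  shows "(\<lambda>z. c * neumann ((z - \<mu>) *\<^sub>C s)) weakly_holomorphic_on ball \<mu> r"
  unfolding weakly_holomorphic_on_def
proof (intro allI impI power_series_holomorphic)
  fix \<phi> :: "'a \<Rightarrow> complex" and z assume \<phi>: "bounded_clinear \<phi>" and z: "z \<in> ball \<mu> r"
  have "(\<lambda>n. \<phi> (c * ((z - \<mu>) *\<^sub>C s) ^ n)) sums \<phi> (c * neumann ((z - \<mu>) *\<^sub>C s))"
    using \<phi> by (intro bounded_linear.sums[of \<phi>] sums_mult neumann_sums small z) (simp add: bounded_clinear_def)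
  then show "(\<lambda>n. \<phi> (c * s ^ n) * (z - \<mu>) ^ n) sums \<phi> (c * neumann ((z - \<mu>) *\<^sub>C s))"
    using \<phi> by (simp add: bounded_clinear_def power_scaleC scaleC_mult_right mult.commute)
qed


section \<open>Differences of commuting elements\<close>

text \<open>The factor \<open>s * neumann (w *\<^sub>C s)\<close> is the regular part of the
  resolvent of \<open>x\<close>: it inverts \<open>x - w *\<^sub>C 1\<close> on the range of the
  idempotent \<open>x * s\<close>.\<close>

lemma drazin_inverse_resolvent:
  fixes x s :: "'a::cbanach_algebra"
  assumes xss: "x * s * s = s" and small: "norm (w *\<^sub>C s) < 1"
  shows "(x - w *\<^sub>C 1) * (s * neumann (w *\<^sub>C s)) = x * s"
proof -
  have "(x - w *\<^sub>C 1) * s = x * s * (1 - w *\<^sub>C s)"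
    by (simp add: left_diff_distrib right_diff_distrib scaleC_mult_left scaleC_mult_right xss)
  then show ?thesis
    by (metis mult.assoc mult.right_neutral neumann_inverse(1)[OF small])
qed

locale commuting_pair =
  fixes a b :: "'a::cbanach_algebra"
  assumes commute: "a * b = b * a"
begin

definition C :: "'a set" where "C = bicommutant {a, b}"

lemma a_in_C: "a \<in> C" and b_in_C: "b \<in> C" and one_in_C: "1 \<in> C"
  by (simp_all add: C_def bicommutant_superset bicommutant_1)

lemmas C_mult = bicommutant_mult[of _ "{a, b}", folded C_def]
  and C_scaleC = bicommutant_scaleC[of _ "{a, b}", folded C_def]
  and C_add = bicommutant_add[of _ "{a, b}", folded C_def]
  and C_diff = bicommutant_diff[of _ "{a, b}", folded C_def]
  and C_neumann = bicommutant_neumann[of _ "{a, b}", folded C_def]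
  and C_drazin_inverse = bicommutant_drazin_inverse[of _ "{a, b}", folded C_def]

lemmas C_intros = a_in_C b_in_C one_in_C C_mult C_scaleC C_add C_diff

text \<open>Since \<open>a\<close> and \<open>b\<close> commute, both lie in the commutant of
  \<open>{a, b}\<close>. Hence \<open>d\<close> commutes with them, and therefore \<open>c\<close>
  commutes with \<open>d\<close>.\<close>

lemma C_commute: assumes "c \<in> C" "d \<in> C" shows "c * d = d * c"
proof -
  have *: "x * d = d * x" if "x \<in> {a, b}" for x
  proof (rule bicommutantD[OF assms(2)[unfolded C_def]])
    show "x * y = y * x" if "y \<in> {a, b}" for y using that \<open>x \<in> {a, b}\<close> commute by auto
  qed
  have "d * c = c * d"
    by (rule bicommutantD[OF assms(1)[unfolded C_def]]) (rule *[symmetric])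
  then show ?thesis by simp
qed

section \<open>The ideal \<open>J\<close> and its relation to Drazin invertibility\<close>

definition J :: "nat \<Rightarrow> 'a set" where
  "J m = {y \<in> C. \<exists>u\<in>C. (a - b) ^ m * y = (a - b) ^ Suc m * u}"

lemma J_mono: assumes "m \<le> n" shows "J m \<subseteq> J n"
proof -
  from assms obtain k where n: "n = k + m" by (metis le_add_diff_inverse2)
  show ?thesis
  proof
    fix y assume "y \<in> J m"
    then obtain u where u: "u \<in> C" "(a - b) ^ m * y = (a - b) ^ Suc m * u" and y: "y \<in> C"
      by (auto simp: J_def)
    have "(a - b) ^ n * y = (a - b) ^ k * ((a - b) ^ m * y)" by (simp add: n power_add mult.assoc)
    also have "\<dots> = (a - b) ^ (k + Suc m) * u" unfolding u(2) power_add by (simp only: mult.assoc)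
    finally show "y \<in> J n" using u(1) y by (auto simp: J_def n)
  qed
qed

lemma J_mult: assumes "y \<in> J m" "c \<in> C" shows "y * c \<in> J m"
proof -
  from assms obtain u where u: "u \<in> C" "(a - b) ^ m * y = (a - b) ^ Suc m * u" and y: "y \<in> C"
    by (auto simp: J_def)
  then have "(a - b) ^ m * (y * c) = (a - b) ^ Suc m * (u * c)" by (metis mult.assoc)
  with u(1) y assms(2) show ?thesis by (auto simp: J_def intro: C_mult)
qed

lemma J_diff: assumes "x \<in> J m" "y \<in> J m" shows "x - y \<in> J m"
proof -
  from assms obtain u v where "u \<in> C" "(a - b) ^ m * x = (a - b) ^ Suc m * u" "x \<in> C"
    and "v \<in> C" "(a - b) ^ m * y = (a - b) ^ Suc m * v" "y \<in> C"
    by (auto simp: J_def)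
  then show ?thesis
    by (auto simp: J_def right_diff_distrib intro!: C_diff bexI[of _ "u - v"])
qed

lemma J_scaleC: assumes "x \<in> J m" shows "k *\<^sub>C x \<in> J m"
  using J_mult[OF assms C_scaleC[OF one_in_C], of k] by (simp add: scaleC_mult_right)

lemma zero_in_C: "0 \<in> C"
  using C_diff[OF one_in_C one_in_C] by simp

lemma zero_in_J: "0 \<in> J m"
  using zero_in_C by (auto simp: J_def intro!: bexI[of _ 0])

lemma subspace_J: "complex_vector.subspace (J m)"
  unfolding complex_vector.subspace_def
proof (intro conjI ballI allI)
  fix x y assume xy: "x \<in> J m" "y \<in> J m"
  then show "x + y \<in> J m"
    using J_diff[OF xy(1) J_scaleC[OF xy(2), of "-1"]] by (simp add: scaleC_minus1)
qed (auto intro: zero_in_J J_scaleC)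

text \<open>An element of \<open>J m\<close> at distance less than 1 from \<open>1\<close> has a
  Neumann inverse in \<open>C\<close>. Multiplying by it gives \<open>(a - b) ^ m\<close> as a
  multiple of \<open>(a - b) ^ Suc m\<close>.\<close>

lemma drazin_if_one_in_closure_J:
  assumes "1 \<in> closure (J m)" shows "\<exists>s. is_drazin_inverse m (a - b) s"
proof -
  from assms obtain y where y: "y \<in> J m" "dist y 1 < 1"
    unfolding closure_approachable by (meson zero_less_one)
  then obtain u where u: "u \<in> C" "(a - b) ^ m * y = (a - b) ^ Suc m * u" and yC: "y \<in> C"
    by (auto simp: J_def)
  have small: "norm (1 - y) < 1" using y(2) by (simp add: dist_norm norm_minus_commute)
  let ?v = "neumann (1 - y)"
  have v: "y * ?v = 1" using neumann_inverse(1)[OF small] by simp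
  have vC: "?v \<in> C" using small yC by (intro C_neumann C_diff one_in_C)
  have "(a - b) ^ m = (a - b) ^ m * y * ?v" by (simp add: mult.assoc v)
  also have "\<dots> = (a - b) ^ Suc m * (u * ?v)" by (simp only: u(2) mult.assoc)
  finally have "(a - b) ^ m = (a - b) ^ Suc m * (u * ?v)" .
  moreover have "(a - b) * (u * ?v) = (u * ?v) * (a - b)"
    using u(1) vC by (intro C_commute C_intros)
  ultimately show ?thesis by (blast intro: is_drazin_inverse_strongly_pi_regular)
qed

section \<open>Local inverses modulo \<open>J\<close>\<close>

definition solves :: "nat \<Rightarrow> complex \<Rightarrow> 'a \<Rightarrow> bool" where
  "solves m z g \<longleftrightarrow> g \<in> C \<and> (a - z *\<^sub>C 1) * g - 1 \<in> J m"

text \<open>Inverses modulo an ideal are unique: multiply each of the two relations by the other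
  solution and subtract.\<close>

lemma solves_unique:
  assumes "solves m z g" "solves m z h" shows "g - h \<in> J m"
proof -
  let ?c = "a - z *\<^sub>C 1"
  have "g \<in> C" "h \<in> C" and J: "?c * g - 1 \<in> J m" "?c * h - 1 \<in> J m"
    using assms by (auto simp: solves_def)
  then have "(?c * g - 1) * h - (?c * h - 1) * g \<in> J m"
    using J_diff J_mult by blast
  moreover have "g * h = h * g" using \<open>g \<in> C\<close> \<open>h \<in> C\<close> by (rule C_commute)
  then have "(?c * g - 1) * h - (?c * h - 1) * g = g - h"
    by (simp add: left_diff_distrib mult.assoc)
  ultimately show ?thesis by simp
qed

definition locally_solvable :: "nat \<Rightarrow> complex \<Rightarrow> bool" where
  "locally_solvable m \<mu> \<longleftrightarrow>
    (\<exists>r>0. \<exists>G. G weakly_holomorphic_on ball \<mu> r \<and> (\<forall>z\<in>ball \<mu> r. solves m z (G z)))"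

lemma locally_solvable_mono: "locally_solvable m \<mu> \<Longrightarrow> m \<le> n \<Longrightarrow> locally_solvable n \<mu>"
  unfolding locally_solvable_def solves_def using J_mono by (meson subsetD)

lemma open_locally_solvable: "open {\<mu>. locally_solvable m \<mu>}"
  unfolding open_contains_ball
proof safe
  fix \<mu> assume "locally_solvable m \<mu>"
  then obtain r G where rG: "0 < r" "G weakly_holomorphic_on ball \<mu> r" "\<And>z. z \<in> ball \<mu> r \<Longrightarrow> solves m z (G z)"
    by (auto simp: locally_solvable_def)
  have "locally_solvable m \<nu>" if \<nu>: "\<nu> \<in> ball \<mu> r" for \<nu>
  proof -
    have "open (ball \<mu> r)" by simp
    then obtain e where e: "0 < e" "ball \<nu> e \<subseteq> ball \<mu> r" using \<nu> open_contains_ball by meson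
    then show ?thesis
      unfolding locally_solvable_def using rG weakly_holomorphic_on_subset by (meson subsetD)
  qed
  with rG(1) show "\<exists>e>0. ball \<mu> e \<subseteq> {\<mu>. locally_solvable m \<mu>}" by blast
qed

text \<open>On the range of both spectral idempotents \<open>a - \<mu>\<close> and
  \<open>b - \<mu>\<close> are nilpotent of orders \<open>k\<close> and \<open>l\<close>, so their
  difference \<open>a - b\<close> is nilpotent of order \<open>k + l\<close>.\<close>

lemma power_a_minus_b_annihilates:
  assumes s: "is_drazin_inverse k (a - \<mu> *\<^sub>C 1) s" and u: "is_drazin_inverse l (b - \<mu> *\<^sub>C 1) u"
  shows "(a - b) ^ (k + l) * ((1 - (a - \<mu> *\<^sub>C 1) * s) * (1 - (b - \<mu> *\<^sub>C 1) * u)) = 0"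
proof -
  let ?x = "a - \<mu> *\<^sub>C 1" and ?y = "b - \<mu> *\<^sub>C 1"
  have C: "?x \<in> C" "?y \<in> C" by (intro C_intros)+
  have C': "s \<in> C" "u \<in> C" using C_drazin_inverse[OF _ s] C_drazin_inverse[OF _ u] C by auto
  let ?p = "1 - ?x * s" and ?q = "1 - ?y * u"
  have pq: "?p * ?q = ?q * ?p" by (intro C_commute C_intros C C')
  have "(?x - ?y) ^ (k + l) * (?p * ?q) = 0"
  proof (rule power_diff_mult_eq_0)
    show "?x * ?y = ?y * ?x" by (intro C_commute C)
    show "?x ^ k * (?p * ?q) = 0"
      using drazin_inverse_annihilator[OF s] by (simp only: mult.assoc[symmetric] mult_zero_left)
    show "?y ^ l * (?p * ?q) = 0"
      unfolding pq using drazin_inverse_annihilator[OF u] by (simp only: mult.assoc[symmetric] mult_zero_left)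
  qed
  then show ?thesis by simp
qed

text \<open>The regular part of the resolvent of \<open>a\<close> inverts \<open>a - z\<close> on
  the range of \<open>x * s\<close>. On the complement given by \<open>p\<close>, write
  \<open>a - z\<close> as \<open>(a - b) + (b - z)\<close> and use the regular part of the resolvent
  of \<open>b\<close>. The error is a multiple of \<open>a - b\<close> and a multiple of
  \<open>(1 - x * s) * (1 - y * u)\<close>; the latter is killed by
  \<open>(a - b) ^ m\<close>.\<close>

lemma locally_solvableI:
  fixes \<mu> :: complex
  defines "x \<equiv> a - \<mu> *\<^sub>C 1" and "y \<equiv> b - \<mu> *\<^sub>C 1"
  assumes s: "s \<in> C" "x * s * s = s" and u: "u \<in> C" "y * u * u = u"
    and annihilates: "(a - b) ^ m * ((1 - x * s) * (1 - y * u)) = 0"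
  shows "locally_solvable m \<mu>"
proof -
  have xC: "x \<in> C" unfolding x_def by (intro C_intros)
  define p where "p = 1 - x * s"
  have pC: "p \<in> C" unfolding p_def by (intro C_intros xC s)
  \<comment> \<open>This radius makes both Neumann series converge; adding 1 keeps the denominator
    positive.\<close>
  define r where "r = 1 / (norm s + norm u + 1)"
  have r: "0 < r" unfolding r_def by (simp add: add_nonneg_pos)
  have small: "norm ((z - \<mu>) *\<^sub>C v) < 1" if "z \<in> ball \<mu> r" "v \<in> {s, u}" for z v
  proof -
    have "norm ((z - \<mu>) *\<^sub>C v) \<le> cmod (z - \<mu>) * (norm s + norm u + 1)"
      unfolding norm_scaleC using that(2) by (intro mult_left_mono) auto
    also have "\<dots> < 1"
      using that(1) r by (simp add: r_def dist_norm norm_minus_commute pos_less_divide_eq add_nonneg_pos)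
    finally show ?thesis .
  qed
  define N :: "'a \<Rightarrow> complex \<Rightarrow> 'a" where "N v z = neumann ((z - \<mu>) *\<^sub>C v)" for v z
  define G where "G z = s * N s z + p * u * N u z" for z
  have "G weakly_holomorphic_on ball \<mu> r"
    unfolding G_def N_def using small
    by (intro weakly_holomorphic_on_add weakly_holomorphic_neumann) auto
  moreover have "solves m z (G z)" if z: "z \<in> ball \<mu> r" for z
  proof -
    let ?c = "a - z *\<^sub>C 1" and ?h = "u * N u z"
    have NC: "N v z \<in> C" if "v \<in> {s, u}" for v
      unfolding N_def using small[OF z that] that s(1) u(1) by (intro C_neumann C_scaleC) auto
    have hC: "?h \<in> C" by (intro C_mult u NC) simp
    have cC: "?c \<in> C" by (intro C_intros)
    have GC: "G z \<in> C" unfolding G_def by (intro C_intros s u pC NC) auto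
    have cx: "?c = x - (z - \<mu>) *\<^sub>C 1" and cy: "?c = (a - b) + (y - (z - \<mu>) *\<^sub>C 1)"
      by (simp_all add: x_def y_def complex_vector.scale_left_diff_distrib)
    have cs: "?c * (s * N s z) = x * s"
      unfolding cx N_def using s(2) small[OF z] by (intro drazin_inverse_resolvent) auto
    have cu: "?c * ?h = (a - b) * ?h + y * u"
    proof -
      have "(y - (z - \<mu>) *\<^sub>C 1) * ?h = y * u"
        unfolding N_def using u(2) small[OF z] by (intro drazin_inverse_resolvent) auto
      then show ?thesis by (simp only: cy distrib_right)
    qed
    have xs: "x * s = 1 - p" by (simp add: p_def)
    have "?c * G z = x * s + p * (?c * ?h)"
      using C_commute[OF cC pC] by (simp only: G_def distrib_left cs mult.assoc) (simp only: cs flip: mult.assoc)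
    also have "\<dots> = x * s + p * (a - b) * ?h + p * (y * u)" by (simp only: cu distrib_left add.assoc mult.assoc)
    also have "p * (a - b) = (a - b) * p" by (intro C_commute C_intros pC)
    finally have eq: "?c * G z - 1 = (a - b) * (p * ?h) - p * (1 - y * u)"
      by (simp add: xs right_diff_distrib mult.assoc)
    have "(a - b) ^ m * (?c * G z - 1) = (a - b) ^ m * ((a - b) * (p * ?h)) - (a - b) ^ m * (p * (1 - y * u))"
      unfolding eq by (rule right_diff_distrib)
    also have "\<dots> = (a - b) ^ m * ((a - b) * (p * ?h))"
      using annihilates by (simp only: p_def diff_zero)
    also have "\<dots> = (a - b) ^ Suc m * (p * ?h)" by (simp only: power_Suc2 mult.assoc)
    finally have "?c * G z - 1 \<in> J m"
      unfolding J_def using GC cC pC hC by (auto intro!: bexI[of _ "p * ?h"] C_intros simp del: power_Suc)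
    then show ?thesis using GC by (simp add: solves_def)
  qed
  ultimately show ?thesis unfolding locally_solvable_def using r by blast
qed

text \<open>If \<open>s\<close> is a genuine inverse then \<open>1 - x * s = 0\<close>, so
  \<open>u = 0\<close> is admissible and exponent 0 suffices.\<close>

lemma locally_solvable_if_left_invertible:
  assumes "is_drazin_inverse 0 (a - \<mu> *\<^sub>C 1) s" shows "locally_solvable 0 \<mu>"
proof -
  have "s \<in> C" using assms by (rule C_drazin_inverse[rotated]) (intro C_intros)
  then show ?thesis
    using assms locally_solvableI[of s \<mu> 0 0] zero_in_C by (simp add: is_drazin_inverse_0_iff)
qed

lemma locally_solvable_if_right_invertible:
  assumes "is_drazin_inverse 0 (b - \<mu> *\<^sub>C 1) s" shows "locally_solvable 0 \<mu>"
proof -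
  have "s \<in> C" using assms by (rule C_drazin_inverse[rotated]) (intro C_intros)
  then show ?thesis
    using assms locally_solvableI[of 0 \<mu> s 0] zero_in_C by (simp add: is_drazin_inverse_0_iff)
qed

lemma locally_solvable_if_drazin:
  assumes s: "is_drazin_inverse k (a - \<mu> *\<^sub>C 1) s" and u: "is_drazin_inverse l (b - \<mu> *\<^sub>C 1) u"
  shows "locally_solvable (k + l) \<mu>"
proof (rule locally_solvableI)
  show "s \<in> C" using s by (rule C_drazin_inverse[rotated]) (intro C_intros)
  show "u \<in> C" using u by (rule C_drazin_inverse[rotated]) (intro C_intros)
qed (use s u power_a_minus_b_annihilates[OF s u] in \<open>auto simp: is_drazin_inverse_def\<close>)

section \<open>The resolvent of \<open>a\<close> near infinity\<close>

context
  fixes z :: complex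
  assumes z: "2 * norm a < cmod z"
begin

text \<open>The factor 2 in the condition on \<open>z\<close> yields a bound on the Neumann series
  that is independent of \<open>z\<close>.\<close>

lemma norm_divide_small: "norm ((1 / z) *\<^sub>C a) < 1 / 2"
  using z by (simp add: norm_scaleC norm_divide divide_simps)

lemma inverse_outside: "is_drazin_inverse 0 (a - z *\<^sub>C 1) ((- 1 / z) *\<^sub>C neumann ((1 / z) *\<^sub>C a))"
proof -
  let ?N = "neumann ((1 / z) *\<^sub>C a)"
  have z0: "z \<noteq> 0" using z by auto
  have N: "(1 - (1 / z) *\<^sub>C a) * ?N = 1" "?N * (1 - (1 / z) *\<^sub>C a) = 1"
    using norm_divide_small neumann_inverse[of "(1 / z) *\<^sub>C a"] by auto
  have "a - z *\<^sub>C 1 = (- z) *\<^sub>C (1 - (1 / z) *\<^sub>C a)"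
    using z0 by (simp add: complex_vector.scale_right_diff_distrib scaleC_scaleC scaleC_one)
  then show ?thesis
    unfolding is_drazin_inverse_0_iff using z0 N
    by (simp add: scaleC_mult_left scaleC_mult_right scaleC_scaleC scaleC_one)
qed

lemma norm_neumann_outside: "norm (neumann ((1 / z) *\<^sub>C a)) \<le> 2 * norm (1 :: 'a)"
proof -
  have "norm (neumann ((1 / z) *\<^sub>C a)) \<le> norm (1 :: 'a) / (1 - norm ((1 / z) *\<^sub>C a))"
    using norm_divide_small by (intro norm_neumann_le) simp
  also have "\<dots> \<le> norm (1 :: 'a) / (1 / 2)"
    using norm_divide_small by (intro divide_left_mono mult_pos_pos) auto
  finally show ?thesis by simp
qed

end

text \<open>Otherwise some \<open>\<phi>\<close> vanishes on \<open>J m\<close> and has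
  \<open>\<phi> 1 = 1\<close>. The resulting entire function \<open>F\<close> tends to 0 at infinity
  and so vanishes identically. But \<open>- z * F z\<close> is \<open>\<phi>\<close> of a Neumann
  series that is close to \<open>1\<close> for large \<open>z\<close>, which is a
  contradiction.\<close>

lemma one_in_closure_J:
  assumes solvable: "\<And>\<mu>. locally_solvable m \<mu>"
  shows "1 \<in> closure (J m)"
proof (rule ccontr)
  assume "1 \<notin> closure (J m)"
  then obtain \<phi> where \<phi>: "bounded_clinear \<phi>" "\<And>y. y \<in> J m \<Longrightarrow> \<phi> y = 0" "\<phi> 1 = 1"
    using Hahn_Banach_separation[OF subspace_J] by metis
  then have lin: "bounded_linear \<phi>" and \<phi>_scale: "\<phi> (c *\<^sub>C y) = c * \<phi> y" for c y
    by (auto simp: bounded_clinear_def)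
  obtain K where K: "0 < K" "\<And>y. cmod (\<phi> y) \<le> norm y * K"
    using bounded_linear.pos_bounded[OF lin] by blast
  \<comment> \<open>The choice is immaterial: two solutions differ by an element of
    \<open>J m\<close>, where \<open>\<phi>\<close> vanishes.\<close>
  define F where "F z = \<phi> (SOME g. solves m z g)" for z
  have F: "F z = \<phi> g" if "solves m z g" for z g
  proof -
    have "solves m z (SOME g. solves m z g)" using that by (rule someI)
    then have "\<phi> ((SOME g. solves m z g) - g) = 0" using that by (intro \<phi>(2) solves_unique)
    then show ?thesis by (simp add: F_def linear_diff[OF bounded_linear.linear[OF lin]])
  qed
  have "F field_differentiable at \<mu>" for \<mu>
  proof -
    from solvable[of \<mu>] obtain r G where rG: "0 < r" "G weakly_holomorphic_on ball \<mu> r"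
      "\<And>z. z \<in> ball \<mu> r \<Longrightarrow> solves m z (G z)"
      by (auto simp: locally_solvable_def)
    have "(\<lambda>z. \<phi> (G z)) holomorphic_on ball \<mu> r"
      using rG(2) \<phi>(1) by (simp add: weakly_holomorphic_on_def)
    then have "F holomorphic_on ball \<mu> r"
      by (rule holomorphic_transform) (use F[OF rG(3)] in auto)
    then show ?thesis using rG(1) by (intro holomorphic_on_imp_differentiable_at[of _ "ball \<mu> r"]) auto
  qed
  then have hol: "F holomorphic_on UNIV"
    by (simp add: holomorphic_on_def)
  have F_outside: "F z = - \<phi> (neumann ((1 / z) *\<^sub>C a)) / z" if "2 * norm a < cmod z" for z
  proof -
    let ?g = "(- 1 / z) *\<^sub>C neumann ((1 / z) *\<^sub>C a)"
    have inv: "is_drazin_inverse 0 (a - z *\<^sub>C 1) ?g" by (rule inverse_outside[OF that])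
    then have "?g \<in> C" by (rule C_drazin_inverse[rotated]) (intro C_intros)
    with inv have "solves m z ?g" by (simp add: solves_def is_drazin_inverse_0_iff zero_in_J)
    then have "F z = \<phi> ?g" by (rule F)
    then show ?thesis by (simp only: \<phi>_scale) simp
  qed
  define M where "M = 2 * norm (1 :: 'a) * K"
  have M: "0 \<le> M" using K by (simp add: M_def)
  have \<phi>_neumann: "cmod (\<phi> (neumann ((1 / z) *\<^sub>C a))) \<le> M" if "2 * norm a < cmod z" for z
    unfolding M_def
    by (rule order_trans[OF K(2) mult_right_mono[OF norm_neumann_outside[OF that]]]) (use K in simp)
  have "(F \<longlongrightarrow> 0) at_infinity"
  proof (rule Lim_null_comparison)
    show "((\<lambda>z. M * inverse (cmod z)) \<longlongrightarrow> 0) at_infinity"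
      by (rule tendsto_mult_right_zero, rule tendsto_inverse_0_at_top, rule filterlim_norm_at_top)
    show "\<forall>\<^sub>F z in at_infinity. cmod (F z) \<le> M * inverse (cmod z)"
      unfolding eventually_at_infinity
    proof (intro exI[of _ "2 * norm a + 1"] allI impI)
      fix z assume "2 * norm a + 1 \<le> cmod z"
      then have "2 * norm a < cmod z" by simp
      then show "cmod (F z) \<le> M * inverse (cmod z)"
        using divide_right_mono[OF \<phi>_neumann[of z], of "cmod z"]
        by (simp add: F_outside norm_divide flip: divide_inverse)
    qed
  qed
  then have F0: "F z = 0" for z by (rule Liouville_weak[OF hol])
  \<comment> \<open>A point outside the disc and so large that the tail of the Neumann series, of
    size at most \<open>M * norm a / cmod z\<close> under \<open>\<phi>\<close>, is below 1.\<close>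
  define z where "z = complex_of_real (2 * norm a + M * norm a + 1)"
  have cz: "cmod z = 2 * norm a + M * norm a + 1"
    unfolding z_def norm_of_real using M by (intro abs_of_nonneg add_nonneg_nonneg mult_nonneg_nonneg) auto
  then have z: "2 * norm a < cmod z" using M mult_nonneg_nonneg[OF M norm_ge_zero[of a]] by linarith
  let ?N = "neumann ((1 / z) *\<^sub>C a)"
  have "\<phi> ?N = 0" using F_outside[OF z] F0[of z] z by auto
  moreover have "?N = 1 + ((1 / z) *\<^sub>C a) * ?N"
    using norm_divide_small[OF z] by (intro neumann_unfold) simp
  then have "\<phi> ?N = 1 + \<phi> (((1 / z) *\<^sub>C a) * ?N)"
    using linear_add[OF bounded_linear.linear[OF lin]] \<phi>(3) by metis
  ultimately have "1 = cmod (\<phi> (((1 / z) *\<^sub>C a) * ?N))"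
    by (metis add_eq_0_iff norm_minus_cancel norm_one)
  also have "\<dots> \<le> norm (((1 / z) *\<^sub>C a) * ?N) * K" by (rule K(2))
  also have "\<dots> \<le> (norm a / cmod z * (2 * norm (1 :: 'a))) * K"
  proof (intro mult_right_mono)
    have "norm (((1 / z) *\<^sub>C a) * ?N) \<le> norm ((1 / z) *\<^sub>C a) * norm ?N" by (rule norm_mult_ineq)
    also have "\<dots> \<le> norm a / cmod z * (2 * norm (1 :: 'a))"
      using norm_neumann_outside[OF z] by (intro mult_mono) (auto simp: norm_scaleC norm_divide)
    finally show "norm (((1 / z) *\<^sub>C a) * ?N) \<le> norm a / cmod z * (2 * norm (1 :: 'a))" .
  qed (use K in simp)
  also have "\<dots> = M * norm a / cmod z" by (simp add: M_def)
  also have "\<dots> < 1"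
  proof -
    have "M * norm a < cmod z" unfolding cz using norm_ge_zero[of a] by linarith
    moreover have "0 < cmod z" using z norm_ge_zero[of a] by linarith
    ultimately show ?thesis by simp
  qed
  finally show False by simp
qed

text \<open>The exponent of local solvability may depend on \<open>\<mu>\<close>. Compactness of the
  disc of radius \<open>2 * norm a\<close> leaves finitely many exponents, and outside it the
  exponent 0 works; as \<open>J\<close> grows with the exponent, the maximum serves
  everywhere.\<close>

theorem drazin_difference:
  assumes "\<And>\<mu>. (\<exists>s. is_drazin_inverse 0 (a - \<mu> *\<^sub>C 1) s) \<or> (\<exists>u. is_drazin_inverse 0 (b - \<mu> *\<^sub>C 1) u) \<or>
    (\<exists>k s l u. is_drazin_inverse k (a - \<mu> *\<^sub>C 1) s \<and> is_drazin_inverse l (b - \<mu> *\<^sub>C 1) u)"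
  shows "\<exists>m s. is_drazin_inverse m (a - b) s"
proof -
  have ex: "\<exists>m. locally_solvable m \<mu>" for \<mu>
    using assms[of \<mu>] locally_solvable_if_left_invertible[of \<mu>] locally_solvable_if_right_invertible[of \<mu>]
      locally_solvable_if_drazin[of _ \<mu>] by blast
  have "compact (cball 0 (2 * norm a) :: complex set)" by simp
  then obtain T where T: "finite T" "cball 0 (2 * norm a) \<subseteq> (\<Union>m\<in>T. {\<mu>. locally_solvable m \<mu>})"
    by (rule compactE_image[of _ UNIV "\<lambda>m. {\<mu>. locally_solvable m \<mu>}"])
      (use ex open_locally_solvable in auto)
  \<comment> \<open>Inserting 0 accounts for the points outside the disc.\<close>
  have "locally_solvable (Max (insert 0 T)) \<mu>" for \<mu>
  proof (cases "\<mu> \<in> cball 0 (2 * norm a)")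
    case True
    then obtain m where "m \<in> T" "locally_solvable m \<mu>" using T(2) by auto
    then show ?thesis using T(1) by (auto intro: locally_solvable_mono)
  next
    case False
    then have "2 * norm a < cmod \<mu>" by simp
    then have "locally_solvable 0 \<mu>" by (intro locally_solvable_if_left_invertible[OF inverse_outside])
    then show ?thesis by (rule locally_solvable_mono) simp
  qed
  then show ?thesis using drazin_if_one_in_closure_J[OF one_in_closure_J] by blast
qed

end


section \<open>Endomorphisms of a Banach space\<close>

lemma norm_cblinfun_apply_le: "norm (cblinfun_apply f x) \<le> norm f * norm x"
  unfolding norm_cblinfun_eq_onorm by (rule onorm[OF bounded_linear_cblinfun_apply])

lemma norm_cblinfun_bound:
  "0 \<le> b \<Longrightarrow> (\<And>x. norm (cblinfun_apply f x) \<le> b * norm x) \<Longrightarrow> norm f \<le> b"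
  unfolding norm_cblinfun_eq_onorm by (rule onorm_bound)

lemma cblinfun_apply_add_left: "cblinfun_apply (f + g) x = cblinfun_apply f x + cblinfun_apply g x"
  and cblinfun_apply_diff_left: "cblinfun_apply (f - g) x = cblinfun_apply f x - cblinfun_apply g x"
  by (transfer, simp add: blinfun.add_left blinfun.diff_left)+

lemma cblinfun_apply_id: "cblinfun_apply id_cblinfun x = x"
  by transfer simp

lemmas cblinfun_compose_add_left = bounded_bilinear.add_left[OF bounded_bilinear_cblinfun_compose]
  and cblinfun_compose_add_right = bounded_bilinear.add_right[OF bounded_bilinear_cblinfun_compose]
  and cblinfun_compose_scaleR_left = bounded_bilinear.scaleR_left[OF bounded_bilinear_cblinfun_compose]
  and cblinfun_compose_scaleR_right = bounded_bilinear.scaleR_right[OF bounded_bilinear_cblinfun_compose]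

lemma cblinfun_compose_scaleC_left: "(c *\<^sub>C f) o\<^sub>C\<^sub>L g = c *\<^sub>C (f o\<^sub>C\<^sub>L g)"
  and cblinfun_compose_scaleC_right: "f o\<^sub>C\<^sub>L (c *\<^sub>C g) = c *\<^sub>C (f o\<^sub>C\<^sub>L g)"
  by (rule cblinfun_eqI; simp add: cblinfun_apply_scaleC_left cblinfun_apply_scaleC_right)+

lemma norm_cblinfun_compose_le: "norm (f o\<^sub>C\<^sub>L g) \<le> norm f * norm g"
  by transfer (rule norm_blinfun_compose)

text \<open>A copy of the type of endomorphisms that can carry the type class of Banach algebras.\<close>

typedef (overloaded) 'a endo = "UNIV :: ('a::complex_normed_vector \<Rightarrow>\<^sub>C\<^sub>L 'a) set"
  morphisms cblinfun_of_endo Endo ..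

setup_lifting type_definition_endo

lift_definition endo_apply :: "'a::complex_normed_vector endo \<Rightarrow> 'a \<Rightarrow> 'a" is cblinfun_apply .

instantiation endo :: (complex_normed_vector) complex_normed_vector
begin

lift_definition zero_endo :: "'a endo" is 0 .
lift_definition plus_endo :: "'a endo \<Rightarrow> 'a endo \<Rightarrow> 'a endo" is "(+)" .
lift_definition minus_endo :: "'a endo \<Rightarrow> 'a endo \<Rightarrow> 'a endo" is "(-)" .
lift_definition uminus_endo :: "'a endo \<Rightarrow> 'a endo" is uminus .
lift_definition scaleR_endo :: "real \<Rightarrow> 'a endo \<Rightarrow> 'a endo" is "(*\<^sub>R)" .
lift_definition scaleC_endo :: "complex \<Rightarrow> 'a endo \<Rightarrow> 'a endo" is "(*\<^sub>C)" .
lift_definition norm_endo :: "'a endo \<Rightarrow> real" is norm .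
lift_definition dist_endo :: "'a endo \<Rightarrow> 'a endo \<Rightarrow> real" is dist .

definition sgn_endo :: "'a endo \<Rightarrow> 'a endo" where
  "sgn_endo f = scaleR (inverse (norm f)) f"

definition uniformity_endo :: "('a endo \<times> 'a endo) filter" where
  "uniformity_endo = (INF e\<in>{0<..}. principal {(f, g). dist f g < e})"

definition open_endo :: "'a endo set \<Rightarrow> bool" where
  "open_endo U \<longleftrightarrow> (\<forall>f\<in>U. \<forall>\<^sub>F (f', g) in uniformity. f' = f \<longrightarrow> g \<in> U)"

instance
proof
  fix f g h :: "'a endo" and r s :: real and c d :: complex
  show "f + g + h = f + (g + h)" by transfer (rule add.assoc)
  show "f + g = g + f" by transfer (rule add.commute)
  show "0 + f = f" by transfer simp
  show "- f + f = 0" by transfer simp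
  show "f - g = f + - g" by transfer simp
  show "r *\<^sub>R (f + g) = r *\<^sub>R f + r *\<^sub>R g" by transfer (rule scaleR_add_right)
  show "(r + s) *\<^sub>R f = r *\<^sub>R f + s *\<^sub>R f" by transfer (rule scaleR_add_left)
  show "r *\<^sub>R s *\<^sub>R f = (r * s) *\<^sub>R f" by transfer simp
  show "1 *\<^sub>R f = f" by transfer simp
  show "dist f g = norm (f - g)" by transfer (rule dist_norm)
  show "sgn f = inverse (norm f) *\<^sub>R f" by (fact sgn_endo_def)
  show "uniformity = (INF e\<in>{0<..}. principal {(f :: 'a endo, g). dist f g < e})"
    by (fact uniformity_endo_def)
  show "open U = (\<forall>f\<in>U. \<forall>\<^sub>F (f', g) in uniformity. f' = f \<longrightarrow> g \<in> U)" for U :: "'a endo set"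
    by (fact open_endo_def)
  show "(norm f = 0) = (f = 0)" by transfer simp
  show "norm (f + g) \<le> norm f + norm g" by transfer (rule norm_triangle_ineq)
  show "norm (r *\<^sub>R f) = \<bar>r\<bar> * norm f" by transfer simp
  show "c *\<^sub>C (f + g) = c *\<^sub>C f + c *\<^sub>C g" by transfer (rule scaleC_add_right)
  show "(c + d) *\<^sub>C f = c *\<^sub>C f + d *\<^sub>C f" by transfer (rule scaleC_add_left)
  show "c *\<^sub>C d *\<^sub>C f = (c * d) *\<^sub>C f" by transfer (rule scaleC_scaleC)
  show "1 *\<^sub>C f = f" by transfer (rule scaleC_one)
  show "r *\<^sub>R f = complex_of_real r *\<^sub>C f" by transfer (rule scaleR_scaleC)
  show "norm (c *\<^sub>C f) = cmod c * norm f" by transfer (rule norm_scaleC)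
qed

end

instantiation endo :: (complex_banach) cbanach_algebra
begin

lift_definition one_endo :: "'a endo" is id_cblinfun .
lift_definition times_endo :: "'a endo \<Rightarrow> 'a endo \<Rightarrow> 'a endo" is "(o\<^sub>C\<^sub>L)" .

instance
proof
  fix f g h :: "'a endo" and r :: real and c :: complex
  show "f * g * h = f * (g * h)" by transfer (rule cblinfun_eqI, simp)
  show "1 * f = f" and "f * 1 = f" by (transfer, rule cblinfun_eqI, simp add: cblinfun_apply_id)+
  show "(f + g) * h = f * h + g * h" by transfer (rule cblinfun_compose_add_left)
  show "f * (g + h) = f * g + f * h" by transfer (rule cblinfun_compose_add_right)
  show "r *\<^sub>R f * g = r *\<^sub>R (f * g)" by transfer (rule cblinfun_compose_scaleR_left)
  show "f * r *\<^sub>R g = r *\<^sub>R (f * g)" by transfer (rule cblinfun_compose_scaleR_right)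
  show "c *\<^sub>C f * g = c *\<^sub>C (f * g)" by transfer (rule cblinfun_compose_scaleC_left)
  show "f * c *\<^sub>C g = c *\<^sub>C (f * g)" by transfer (rule cblinfun_compose_scaleC_right)
  show "norm (f * g) \<le> norm f * norm g" by transfer (rule norm_cblinfun_compose_le)
next
  fix X :: "nat \<Rightarrow> 'a endo" assume X: "Cauchy X"
  then have "Cauchy (\<lambda>n. cblinfun_of_endo (X n))"
    by (simp add: Cauchy_def dist_endo.rep_eq)
  then obtain L where "(\<lambda>n. cblinfun_of_endo (X n)) \<longlonglongrightarrow> L"
    using Cauchy_convergent convergent_def by blast
  then have "X \<longlonglongrightarrow> Endo L"
    by (simp add: tendsto_iff dist_endo.rep_eq Endo_inverse)
  then show "convergent X" by (rule convergentI)
qed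

end

lemma endo_eqI: "(\<And>x. endo_apply S x = endo_apply T x) \<Longrightarrow> S = T"
  by transfer (rule cblinfun_eqI)

context
  fixes S T :: "'a::complex_banach endo"
begin

lemma endo_apply_mult [simp]: "endo_apply (S * T) x = endo_apply S (endo_apply T x)"
  by transfer simp

lemma endo_apply_one [simp]: "endo_apply 1 (x :: 'a) = x"
  by transfer (rule cblinfun_apply_id)

lemma endo_apply_left_add: "endo_apply (S + T) x = endo_apply S x + endo_apply T x"
  and endo_apply_left_diff: "endo_apply (S - T) x = endo_apply S x - endo_apply T x"
  and endo_apply_left_scaleC: "endo_apply (c *\<^sub>C S) x = c *\<^sub>C endo_apply S x"
  by (transfer, rule cblinfun_apply_add_left cblinfun_apply_diff_left cblinfun_apply_scaleC_left)+

lemma bounded_linear_endo_apply: "bounded_linear (endo_apply T)"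
  by transfer (rule bounded_linear_cblinfun_apply)

lemma endo_apply_scaleC: "endo_apply T (c *\<^sub>C x) = c *\<^sub>C endo_apply T x"
  by transfer (rule cblinfun_apply_scaleC_right)

lemma norm_endo_apply_le: "norm (endo_apply T x) \<le> norm T * norm x"
  by transfer (rule norm_cblinfun_apply_le)

end

lemmas endo_apply_add = linear_add[OF bounded_linear.linear[OF bounded_linear_endo_apply]]
  and endo_apply_zero [simp] = linear_0[OF bounded_linear.linear[OF bounded_linear_endo_apply]]

lemma endo_apply_Endo: "endo_apply (Endo f) x = cblinfun_apply f x"
  by (simp add: endo_apply.rep_eq Endo_inverse)

section \<open>Drazin inverses from estimates on the range of a power\<close>

lemma complex_subspace_closure:
  fixes M :: "'a::complex_normed_vector set"
  assumes M: "complex_vector.subspace M" shows "complex_vector.subspace (closure M)"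
  unfolding complex_vector.subspace_def
proof (intro conjI ballI allI)
  show "0 \<in> closure M" using complex_vector.subspace_0[OF M] closure_subset by blast
next
  fix x y assume "x \<in> closure M" "y \<in> closure M"
  then obtain f g where fg: "\<And>n. f n \<in> M" "f \<longlonglongrightarrow> x" "\<And>n. g n \<in> M" "g \<longlonglongrightarrow> y"
    unfolding closure_sequential by blast
  then have "(\<lambda>n. f n + g n) \<longlonglongrightarrow> x + y" by (intro tendsto_add)
  moreover have "f n + g n \<in> M" for n by (intro complex_vector.subspace_add[OF M] fg)
  ultimately show "x + y \<in> closure M" unfolding closure_sequential by (intro exI[of _ "\<lambda>n. f n + g n"]) simp
next
  fix c x assume "x \<in> closure M"
  then obtain f where f: "\<And>n. f n \<in> M" "f \<longlonglongrightarrow> x" unfolding closure_sequential by blast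
  then have "(\<lambda>n. c *\<^sub>C f n) \<longlonglongrightarrow> c *\<^sub>C x" by (intro bounded_linear.tendsto[OF bounded_linear_scaleC])
  moreover have "c *\<^sub>C f n \<in> M" for n by (intro complex_vector.subspace_scale[OF M] f)
  ultimately show "c *\<^sub>C x \<in> closure M" unfolding closure_sequential by (intro exI[of _ "\<lambda>n. c *\<^sub>C f n"]) simp
qed

lemma complex_subspace_range_endo:
  fixes T :: "'a::complex_banach endo"
  shows "complex_vector.subspace (range (endo_apply T))"
  unfolding complex_vector.subspace_def
proof (intro conjI ballI allI)
  show "0 \<in> range (endo_apply T)" by (rule range_eqI[of _ _ 0]) simp
qed (auto simp flip: endo_apply_add endo_apply_scaleC)

text \<open>On the closure \<open>M\<close> of the range of \<open>T ^ m\<close> the operator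
  \<open>T\<close> is bounded below and onto, hence boundedly invertible. The Drazin inverse applies
  \<open>T ^ m\<close> and then inverts \<open>T ^ Suc m\<close> on \<open>M\<close>. For
  \<open>m = 0\<close> this says that an operator bounded below with dense range is
  invertible.\<close>

proposition drazin_inverse_if_bounded_below:
  fixes T :: "'a::complex_banach endo"
  assumes below: "\<And>x. norm (endo_apply (T ^ m) x) \<le> K * norm (endo_apply (T ^ Suc m) x)"
    and dense: "range (endo_apply (T ^ m)) \<subseteq> closure (range (endo_apply (T ^ Suc m)))"
  shows "\<exists>D. is_drazin_inverse m T D"
proof -
  define M where "M = closure (range (endo_apply (T ^ m)))"
  define K' where "K' = max K 1"
  have K': "0 < K'" "K \<le> K'" by (simp_all add: K'_def)
  have subM: "complex_vector.subspace M"
    unfolding M_def by (intro complex_subspace_closure complex_subspace_range_endo)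
  have range_M: "endo_apply (T ^ m) x \<in> M" for x
    unfolding M_def by (rule subsetD[OF closure_subset]) simp
  have cont: "continuous_on A (endo_apply S)" for A and S :: "'a endo"
    using bounded_linear_endo_apply by (rule linear_continuous_on)
  have Suc_apply: "endo_apply T (endo_apply (T ^ k) x) = endo_apply (T ^ Suc k) x"
    "endo_apply (T ^ k) (endo_apply T x) = endo_apply (T ^ Suc k) x" for k x
    by (simp, simp add: power_Suc2 del: power_Suc)
  have range_Suc: "endo_apply T ` range (endo_apply (T ^ m)) = range (endo_apply (T ^ Suc m))"
    by (auto simp: image_image)
  have range_Suc_subset: "range (endo_apply (T ^ Suc m)) \<subseteq> range (endo_apply (T ^ m))"
    unfolding Suc_apply(2)[symmetric] by blast
  have TM: "endo_apply T z \<in> M" if "z \<in> M" for z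
  proof -
    have "endo_apply T ` M \<subseteq> M"
      unfolding M_def
    proof (rule image_closure_subset)
      show "endo_apply T ` range (endo_apply (T ^ m)) \<subseteq> closure (range (endo_apply (T ^ m)))"
        unfolding range_Suc using range_Suc_subset closure_subset by (rule order_trans)
    qed (simp_all add: cont)
    with that show ?thesis by blast
  qed
  have TkM: "endo_apply (T ^ k) z \<in> M" if "z \<in> M" for k z
    by (induction k) (simp_all add: that TM)
  have belowM: "norm z \<le> K' * norm (endo_apply T z)" if "z \<in> M" for z
  proof -
    have "M \<subseteq> {z. norm z \<le> K' * norm (endo_apply T z)}"
      unfolding M_def
    proof (rule closure_minimal)
      show "range (endo_apply (T ^ m)) \<subseteq> {z. norm z \<le> K' * norm (endo_apply T z)}"
      proof (clarsimp simp: Suc_apply simp del: power_Suc)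
        fix x
        show "norm (endo_apply (T ^ m) x) \<le> K' * norm (endo_apply (T ^ Suc m) x)"
          using below[of x] mult_right_mono[OF K'(2), of "norm (endo_apply (T ^ Suc m) x)"] by simp
      qed
      show "closed {z. norm z \<le> K' * norm (endo_apply T z)}"
        by (intro closed_Collect_le continuous_on_norm continuous_on_mult continuous_on_const
            continuous_on_id cont)
    qed
    with that show ?thesis by blast
  qed
  have belowMk: "norm z \<le> K' ^ k * norm (endo_apply (T ^ k) z)" if "z \<in> M" for k z
  proof (induction k)
    case (Suc k)
    note Suc.IH
    also have "K' ^ k * norm (endo_apply (T ^ k) z) \<le> K' ^ k * (K' * norm (endo_apply (T ^ Suc k) z))"
      using belowM[OF TkM[OF that, of k]] K' by (intro mult_left_mono) simp_all
    finally show ?case by (simp add: mult_ac)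
  qed simp
  have surj: "\<exists>z\<in>M. endo_apply T z = w" if w: "w \<in> M" for w
  proof -
    \<comment> \<open>An operator bounded below on a complete subspace has complete, hence closed,
      image; density of that image in \<open>M\<close> then gives surjectivity.\<close>
    have "complete (endo_apply T ` M)"
    proof (rule complete_isometric_image)
      show "0 < 1 / K'" using K' by simp
      show "subspace M" using subM by (rule complex_subspace_imp_subspace)
      show "bounded_linear (endo_apply T)" by (rule bounded_linear_endo_apply)
      show "\<forall>z\<in>M. 1 / K' * norm z \<le> norm (endo_apply T z)"
        using belowM K' by (simp add: field_simps)
      show "complete M" by (simp add: M_def complete_eq_closed)
    qed
    then have "closed (endo_apply T ` M)" by (simp add: complete_eq_closed)
    moreover have "range (endo_apply (T ^ Suc m)) \<subseteq> endo_apply T ` M"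
      unfolding range_Suc[symmetric] using range_M by blast
    ultimately have "closure (range (endo_apply (T ^ Suc m))) \<subseteq> endo_apply T ` M"
      by (intro closure_minimal)
    moreover have "M \<subseteq> closure (range (endo_apply (T ^ Suc m)))"
      unfolding M_def using dense by (intro closure_minimal) auto
    ultimately show ?thesis using w by blast
  qed
  have surjk: "\<exists>z\<in>M. endo_apply (T ^ k) z = w" if "w \<in> M" for k w
    using that
  proof (induction k arbitrary: w)
    case (Suc k)
    obtain v where v: "v \<in> M" "endo_apply T v = w" using surj Suc.prems by blast
    obtain z where "z \<in> M" "endo_apply (T ^ k) z = v" using Suc.IH[OF v(1)] by blast
    with v show ?case by auto
  qed simp
  have inj: "z = z'" if "z \<in> M" "z' \<in> M" "endo_apply (T ^ k) z = endo_apply (T ^ k) z'" for k z z'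
  proof -
    have "z - z' \<in> M" using that by (intro complex_vector.subspace_diff[OF subM])
    moreover have "endo_apply (T ^ k) (z - z') = 0"
      using that by (simp add: linear_diff[OF bounded_linear.linear[OF bounded_linear_endo_apply]])
    ultimately show ?thesis using belowMk[of "z - z'" k] by simp
  qed
  define D where "D x = (THE z. z \<in> M \<and> endo_apply (T ^ Suc m) z = endo_apply (T ^ m) x)" for x
  have D: "D x \<in> M \<and> endo_apply (T ^ Suc m) (D x) = endo_apply (T ^ m) x" for x
    unfolding D_def
  proof (rule theI', rule ex_ex1I)
    show "\<exists>z. z \<in> M \<and> endo_apply (T ^ Suc m) z = endo_apply (T ^ m) x"
      using surjk[OF range_M, of "Suc m" x] by blast
    show "z = z'" if "z \<in> M \<and> endo_apply (T ^ Suc m) z = endo_apply (T ^ m) x"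
      "z' \<in> M \<and> endo_apply (T ^ Suc m) z' = endo_apply (T ^ m) x" for z z'
      using that by (intro inj[of z z' "Suc m"]) simp_all
  qed
  have D_eqI: "D x = z" if "z \<in> M" "endo_apply (T ^ Suc m) z = endo_apply (T ^ m) x" for x z
  proof (rule inj)
    show "endo_apply (T ^ Suc m) (D x) = endo_apply (T ^ Suc m) z" by (simp only: D that(2))
  qed (use D that(1) in blast)+
  have D_add: "D (x + y) = D x + D y" for x y
    by (intro D_eqI complex_vector.subspace_add[OF subM]) (simp_all only: D endo_apply_add)
  have D_scaleC: "D (c *\<^sub>C x) = c *\<^sub>C D x" for c x
    by (intro D_eqI complex_vector.subspace_scale[OF subM]) (simp_all only: D endo_apply_scaleC)
  have "norm (D x) \<le> norm x * (K' ^ Suc m * norm (T ^ m))" for x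
  proof -
    have "norm (D x) \<le> K' ^ Suc m * norm (endo_apply (T ^ m) x)"
      using belowMk[of "D x" "Suc m"] D[of x] by (simp only: simp_thms)
    also have "\<dots> \<le> K' ^ Suc m * (norm (T ^ m) * norm x)"
      using K' by (intro mult_left_mono norm_endo_apply_le) auto
    finally show ?thesis by (simp add: mult_ac)
  qed
  then have "bounded_linear D"
    by (intro bounded_linear_intro) (auto simp: D_add D_scaleC scaleR_scaleC)
  then have D_apply: "endo_apply (Endo (Cblinfun D)) = D"
    by (simp add: endo_apply_Endo fun_eq_iff cblinfun_apply_Cblinfun D_scaleC)
  have DT: "D (endo_apply T x) = endo_apply T (D x)" for x
  proof (rule D_eqI)
    show "endo_apply T (D x) \<in> M" using D TM by blast
    have "endo_apply (T ^ Suc m) (endo_apply T (D x)) = endo_apply T (endo_apply (T ^ Suc m) (D x))"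
      by (simp only: Suc_apply)
    then show "endo_apply (T ^ Suc m) (endo_apply T (D x)) = endo_apply (T ^ m) (endo_apply T x)"
      using D[of x] by (simp only: Suc_apply)
  qed
  have "is_drazin_inverse m T (Endo (Cblinfun D))"
    unfolding is_drazin_inverse_def
  proof (intro conjI endo_eqI)
    fix x
    show "endo_apply (T ^ m) x = endo_apply (T ^ m * Endo (Cblinfun D) * T) x"
      using D[of x] by (simp only: endo_apply_mult D_apply DT Suc_apply(2))
    show "endo_apply (Endo (Cblinfun D) * T * Endo (Cblinfun D)) x = endo_apply (Endo (Cblinfun D)) x"
      unfolding endo_apply_mult D_apply using D[of x] by (intro D_eqI) (simp_all only: Suc_apply(2))
    show "endo_apply (T * Endo (Cblinfun D)) x = endo_apply (Endo (Cblinfun D) * T) x"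
      by (simp add: D_apply DT)
  qed
  then show ?thesis by blast
qed


section \<open>Left and right multiplication operators\<close>

definition endo_left :: "'x::complex_banach endo \<Rightarrow> ('y::complex_banach \<Rightarrow>\<^sub>C\<^sub>L 'x) endo" where
  "endo_left A = Endo (Cblinfun (\<lambda>U. cblinfun_of_endo A o\<^sub>C\<^sub>L U))"

definition endo_right :: "'y::complex_banach endo \<Rightarrow> ('y \<Rightarrow>\<^sub>C\<^sub>L 'x::complex_banach) endo" where
  "endo_right B = Endo (Cblinfun (\<lambda>U. U o\<^sub>C\<^sub>L cblinfun_of_endo B))"

lemma endo_left_apply: "endo_apply (endo_left A) U = cblinfun_of_endo A o\<^sub>C\<^sub>L U"
  unfolding endo_left_def endo_apply_Endo
  by (subst cblinfun_apply_Cblinfun)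
    (simp_all add: bounded_bilinear.bounded_linear_right[OF bounded_bilinear_cblinfun_compose]
      cblinfun_compose_scaleC_right)

lemma endo_right_apply: "endo_apply (endo_right B) U = U o\<^sub>C\<^sub>L cblinfun_of_endo B"
  unfolding endo_right_def endo_apply_Endo
  by (subst cblinfun_apply_Cblinfun)
    (simp_all add: bounded_bilinear.bounded_linear_left[OF bounded_bilinear_cblinfun_compose]
      cblinfun_compose_scaleC_left)

lemma endo_left_apply_apply: "cblinfun_apply (endo_apply (endo_left A) U) y = endo_apply A (cblinfun_apply U y)"
  and endo_right_apply_apply: "cblinfun_apply (endo_apply (endo_right B) U) y = cblinfun_apply U (endo_apply B y)"
  by (simp_all only: endo_left_apply endo_right_apply cblinfun_compose_apply, simp_all only: endo_apply.rep_eq)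

lemma cblinfun_apply_zero_left: "cblinfun_apply 0 x = 0"
  by transfer simp

lemma endo_hom_space_eqI:
  "(\<And>U y. cblinfun_apply (endo_apply S U) y = cblinfun_apply (endo_apply T U) y) \<Longrightarrow> S = T"
  by (intro endo_eqI cblinfun_eqI)

lemma cblinfun_apply_diff_right: "cblinfun_apply f (x - y) = cblinfun_apply f x - cblinfun_apply f y"
  by (rule linear_diff[OF bounded_linear.linear[OF bounded_linear_cblinfun_apply]])

lemma endo_left_mult: "endo_left (A * B) = endo_left A * endo_left B"
  and endo_left_one: "endo_left 1 = 1"
  and endo_left_diff: "endo_left (A - B) = endo_left A - endo_left B"
  and endo_left_scaleC: "endo_left (c *\<^sub>C A) = c *\<^sub>C endo_left A"
  by (rule endo_hom_space_eqI;
      simp add: endo_left_apply_apply endo_apply_left_diff endo_apply_left_scaleC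
        cblinfun_apply_diff_left cblinfun_apply_scaleC_left)+

lemma endo_right_mult: "endo_right (A * B) = endo_right B * endo_right A"
  and endo_right_one: "endo_right 1 = 1"
  and endo_right_diff: "endo_right (A - B) = endo_right A - endo_right B"
  and endo_right_scaleC: "endo_right (c *\<^sub>C A) = c *\<^sub>C endo_right A"
  by (rule endo_hom_space_eqI;
      simp add: endo_right_apply_apply endo_apply_left_diff endo_apply_left_scaleC
        cblinfun_apply_diff_left cblinfun_apply_scaleC_left cblinfun_apply_diff_right cblinfun_apply_scaleC_right)+

lemma endo_left_power: "endo_left (A ^ n) = endo_left A ^ n"
  by (induction n) (simp_all add: endo_left_one endo_left_mult)

lemma endo_right_power: "endo_right (B ^ n) = endo_right B ^ n"
  by (induction n) (simp_all add: endo_right_one endo_right_mult power_commutes)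

lemma endo_left_right_commute: "endo_left A * endo_right B = endo_right B * endo_left A"
  by (rule endo_hom_space_eqI) (simp add: endo_left_apply_apply endo_right_apply_apply)

lemma endo_left_drazin:
  "is_drazin_inverse m A S \<Longrightarrow> is_drazin_inverse m (endo_left A) (endo_left S)"
  unfolding is_drazin_inverse_def by (simp flip: endo_left_power endo_left_mult)

text \<open>Right multiplication reverses products, so the equation required is
  \<open>B ^ m = B * (S * B ^ m)\<close>; it follows because \<open>S\<close> commutes with
  \<open>B\<close>.\<close>

lemma endo_right_drazin:
  assumes "is_drazin_inverse m B S" shows "is_drazin_inverse m (endo_right B) (endo_right S)"
proof -
  have "B ^ m = B * (S * B ^ m)"
    using is_drazin_inverse_imp_generates[OF assms] assms
    by (metis is_drazin_inverse_def mult.assoc power_Suc)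
  moreover have "S * (B * S) = S" "S * B = B * S"
    using assms unfolding is_drazin_inverse_def by (metis mult.assoc)+
  ultimately show ?thesis
    unfolding is_drazin_inverse_def endo_right_power[symmetric] endo_right_mult[symmetric]
    by (metis mult.assoc)
qed

section \<open>Rank one operators and approximate null pairs\<close>

definition rank_one :: "'x::complex_banach \<Rightarrow> ('y::complex_banach \<Rightarrow> complex) \<Rightarrow> ('y \<Rightarrow>\<^sub>C\<^sub>L 'x)" where
  "rank_one x f = Cblinfun (\<lambda>y. f y *\<^sub>C x)"

lemma rank_one_apply:
  assumes f: "bounded_clinear f" shows "cblinfun_apply (rank_one x f) y = f y *\<^sub>C x"
proof -
  have lin: "bounded_linear f" and scale: "\<And>c y. f (c *\<^sub>C y) = c * f y"
    using f by (auto simp: bounded_clinear_def)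
  obtain K where K: "\<And>y. cmod (f y) \<le> norm y * K" using bounded_linear.bounded[OF lin] by blast
  have "norm (f y *\<^sub>C x) \<le> norm y * (K * norm x)" for y
    using mult_right_mono[OF K[of y] norm_ge_zero[of x]] by (simp add: norm_scaleC mult.assoc)
  then have "bounded_linear (\<lambda>y. f y *\<^sub>C x)"
    by (intro bounded_linear_intro)
      (auto simp: linear_add[OF bounded_linear.linear[OF lin]] scaleC_add_left scaleR_scaleC scale scaleC_scaleC)
  then show ?thesis by (simp add: rank_one_def cblinfun_apply_Cblinfun scale scaleC_scaleC)
qed

lemma norm_rank_one_le:
  assumes f: "bounded_clinear f" and K: "\<And>y. cmod (f y) \<le> K * norm y" "0 \<le> K"
  shows "norm (rank_one x f) \<le> K * norm x"
proof (rule norm_cblinfun_bound)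
  show "norm (cblinfun_apply (rank_one x f) y) \<le> K * norm x * norm y" for y
    using mult_right_mono[OF K(1)[of y] norm_ge_zero[of x]]
    by (simp add: rank_one_apply[OF f] norm_scaleC mult_ac)
qed (use K in simp)

lemma endo_left_rank_one: "bounded_clinear f \<Longrightarrow> endo_apply (endo_left A) (rank_one x f) = rank_one (endo_apply A x) f"
  by (rule cblinfun_eqI) (simp add: endo_left_apply_apply rank_one_apply endo_apply_scaleC)

text \<open>
  A non-invertible operator fails to be bounded below, or its range is not dense. In the first case
  \<open>y\<close> is an approximate null vector normalised by \<open>f\<close>, in the second case \<open>f\<close> annihilates the range.
\<close>

lemma not_invertible_null_pair:
  fixes B :: "'a::complex_banach endo"
  assumes not_inv: "\<nexists>s. is_drazin_inverse 0 B s"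
  obtains K where "0 \<le> K" and "\<And>\<epsilon>::real. 0 < \<epsilon> \<Longrightarrow> \<exists>f y \<beta>. bounded_clinear f \<and> f y = 1 \<and> 0 \<le> \<beta> \<and>
    (\<forall>v. cmod (f v) \<le> \<beta> * norm v) \<and> \<beta> * norm y \<le> K \<and>
    ((\<forall>v. f (endo_apply B v) = 0) \<or> \<beta> * norm (endo_apply B y) \<le> \<epsilon>)"
proof (cases "\<exists>k. \<forall>x. norm x \<le> k * norm (endo_apply B x)")
  case True
  \<comment> \<open>Being bounded below, \<open>B\<close> would be invertible by the case
    \<open>m = 0\<close> of \<open>drazin_inverse_if_bounded_below\<close> if its range were
    dense.\<close>
  then have "\<not> UNIV \<subseteq> closure (range (endo_apply B))"
    using not_inv drazin_inverse_if_bounded_below[where m = 0 and T = B] by auto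
  then obtain y where y: "y \<notin> closure (range (endo_apply B))" by blast
  let ?\<beta> = "2 / infdist y (range (endo_apply B))"
  obtain f where f: "bounded_clinear f" "\<And>v. v \<in> range (endo_apply B) \<Longrightarrow> f v = 0" "f y = 1"
    "\<And>v. norm (f v) \<le> ?\<beta> * norm v"
    using Hahn_Banach_separation[OF complex_subspace_range_endo y] by blast
  have \<beta>: "0 \<le> ?\<beta>" by (simp add: infdist_nonneg)
  show thesis
  proof (rule that)
    show "\<exists>f z \<beta>. bounded_clinear f \<and> f z = 1 \<and> 0 \<le> \<beta> \<and>
        (\<forall>v. cmod (f v) \<le> \<beta> * norm v) \<and> \<beta> * norm z \<le> ?\<beta> * norm y \<and>
        ((\<forall>v. f (endo_apply B v) = 0) \<or> \<beta> * norm (endo_apply B z) \<le> \<epsilon>)" for \<epsilon>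
      using f \<beta> by (intro exI[of _ f] exI[of _ y] exI[of _ "?\<beta>"]) blast
  qed (use \<beta> in simp)
next
  case False
  show thesis
  proof (rule that[of 2])
    fix \<epsilon> :: real assume \<epsilon>: "0 < \<epsilon>"
    \<comment> \<open>The bound fails for the constant \<open>2 / \<epsilon>\<close>, chosen to
      cancel the norm bound \<open>2 / norm x\<close> of the norming functional.\<close>
    obtain x where x: "2 / \<epsilon> * norm (endo_apply B x) < norm x"
      using False by (metis linorder_not_le)
    then have x0: "x \<noteq> 0" by auto
    obtain f where f: "bounded_clinear f" "f x = 1" "\<And>v. norm (f v) \<le> 2 / norm x * norm v"
      using norming_functional[OF x0] by blast
    have "2 / norm x * norm (endo_apply B x) \<le> \<epsilon>"
      using x x0 \<epsilon> by (simp add: field_simps)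
    with f x0 show "\<exists>f y \<beta>. bounded_clinear f \<and> f y = 1 \<and> 0 \<le> \<beta> \<and>
        (\<forall>v. cmod (f v) \<le> \<beta> * norm v) \<and> \<beta> * norm y \<le> 2 \<and>
        ((\<forall>v. f (endo_apply B v) = 0) \<or> \<beta> * norm (endo_apply B y) \<le> \<epsilon>)"
      by (intro exI[of _ f] exI[of _ x] exI[of _ "2 / norm x"]) auto
  qed simp
qed

section \<open>Necessity: Drazin invertibility of the coefficients\<close>

lemma le_if_le_add_epsilon_mult:
  fixes a b c :: real
  assumes "\<And>\<epsilon>. 0 < \<epsilon> \<Longrightarrow> a \<le> b + \<epsilon> * c" "0 \<le> c" shows "a \<le> b"
proof (rule field_le_epsilon)
  fix e :: real assume e: "0 < e"
  have "a \<le> b + e / (c + 1) * c" using e assms(2) by (intro assms(1)) (simp add: add_nonneg_pos)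
  also have "e / (c + 1) * c \<le> e" using e assms(2) by (simp add: field_simps)
  finally show "a \<le> b + e" by simp
qed

text \<open>Apply \<open>?L ^ m = s * ?L ^ Suc m + w * ?R\<close> to the rank one operator of
  \<open>x\<close> and \<open>f\<close> and evaluate at \<open>y\<close>. The left side is
  \<open>A ^ m\<close> at \<open>x\<close>. As \<open>s\<close> commutes with \<open>?L\<close>, the
  main term lies in the range of \<open>A ^ Suc m\<close> and is also bounded by a multiple of the
  norm of \<open>A ^ Suc m\<close> at \<open>x\<close>. Letting the remainder tend to 0 gives the
  hypotheses of \<open>drazin_inverse_if_bounded_below\<close>.\<close>

theorem drazin_left_if_right_not_invertible:
  fixes A :: "'x::complex_banach endo" and B :: "'y::complex_banach endo"
  assumes s: "is_drazin_inverse m (endo_left A - endo_right B) s"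
    and not_inv: "\<nexists>u. is_drazin_inverse 0 B u"
  shows "\<exists>D. is_drazin_inverse m A D"
proof -
  let ?L = "endo_left A :: ('y \<Rightarrow>\<^sub>C\<^sub>L 'x) endo" and ?R = "endo_right B :: ('y \<Rightarrow>\<^sub>C\<^sub>L 'x) endo"
  obtain w where w: "?L ^ m = s * ?L ^ Suc m + w * ?R" "w * ?R = ?R * w" "s * ?L = ?L * s"
    using drazin_difference_remainder[OF endo_left_right_commute s] by blast
  have sL: "s * ?L ^ n = ?L ^ n * s" for n
    using power_commuting_commutes[OF w(3)[symmetric]] by simp
  obtain K where K: "0 \<le> K" and pair: "\<And>\<epsilon>::real. 0 < \<epsilon> \<Longrightarrow> \<exists>f y \<beta>. bounded_clinear f \<and> f y = 1 \<and> 0 \<le> \<beta> \<and>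
    (\<forall>v. cmod (f v) \<le> \<beta> * norm v) \<and> \<beta> * norm y \<le> K \<and>
    ((\<forall>v. f (endo_apply B v) = 0) \<or> \<beta> * norm (endo_apply B y) \<le> \<epsilon>)"
    using not_invertible_null_pair[OF not_inv] by blast
  have approx: "\<exists>v. norm (endo_apply (A ^ m) x - endo_apply (A ^ Suc m) v) \<le> \<epsilon> * (norm w * norm x) \<and>
      norm (endo_apply (A ^ Suc m) v) \<le> (norm s * K) * norm (endo_apply (A ^ Suc m) x)"
    if \<epsilon>: "0 < \<epsilon>" for \<epsilon> x
  proof -
    obtain f y \<beta> where f: "bounded_clinear f" "f y = 1" "0 \<le> \<beta>" "\<And>v. cmod (f v) \<le> \<beta> * norm v"
      "\<beta> * norm y \<le> K" and null: "(\<forall>v. f (endo_apply B v) = 0) \<or> \<beta> * norm (endo_apply B y) \<le> \<epsilon>"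
      using pair[OF \<epsilon>] by blast
    let ?U = "\<lambda>x. rank_one x f :: 'y \<Rightarrow>\<^sub>C\<^sub>L 'x"
    have LU: "endo_apply (?L ^ n) (?U x) = ?U (endo_apply (A ^ n) x)" for n x
      by (simp add: endo_left_rank_one[OF f(1)] flip: endo_left_power)
    let ?v = "cblinfun_apply (endo_apply s (?U x)) y"
    have Av: "endo_apply (A ^ Suc m) ?v = cblinfun_apply (endo_apply s (?U (endo_apply (A ^ Suc m) x))) y"
    proof -
      have "endo_apply (s * ?L ^ Suc m) (?U x) = endo_apply (?L ^ Suc m * s) (?U x)" by (simp only: sL)
      then show ?thesis
        by (simp only: endo_apply_mult LU) (simp only: endo_left_apply_apply flip: endo_left_power)
    qed
    have "endo_apply (A ^ m) x = cblinfun_apply (endo_apply (?L ^ m) (?U x)) y"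
      by (simp add: LU rank_one_apply f scaleC_one)
    also have "\<dots> = endo_apply (A ^ Suc m) ?v + cblinfun_apply (endo_apply (w * ?R) (?U x)) y"
      unfolding w(1) by (simp only: endo_apply_left_add cblinfun_apply_add_left endo_apply_mult LU Av)
    finally have diff: "endo_apply (A ^ m) x - endo_apply (A ^ Suc m) ?v =
      cblinfun_apply (endo_apply (w * ?R) (?U x)) y"
      by simp
    have U_norm: "norm (?U x) \<le> \<beta> * norm x" for x
      by (rule norm_rank_one_le[OF f(1,4,3)])
    \<comment> \<open>If \<open>f\<close> annihilates the range of \<open>B\<close>, then
      \<open>?R\<close> kills the rank one operator. Otherwise \<open>w * ?R = ?R * w\<close> moves
      \<open>B\<close> onto \<open>y\<close>, where it is small.\<close>
    have "norm (cblinfun_apply (endo_apply (w * ?R) (?U x)) y) \<le> \<epsilon> * (norm w * norm x)"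
      using null
    proof
      assume "\<forall>v. f (endo_apply B v) = 0"
      then have "endo_apply ?R (?U x) = 0"
        by (intro cblinfun_eqI) (simp add: endo_right_apply_apply rank_one_apply f cblinfun_apply_zero_left)
      then show ?thesis using \<epsilon> by (simp add: cblinfun_apply_zero_left)
    next
      assume small: "\<beta> * norm (endo_apply B y) \<le> \<epsilon>"
      have "norm (cblinfun_apply (endo_apply (w * ?R) (?U x)) y) =
          norm (cblinfun_apply (endo_apply w (?U x)) (endo_apply B y))"
        unfolding w(2) by (simp add: endo_right_apply_apply)
      also have "\<dots> \<le> norm (endo_apply w (?U x)) * norm (endo_apply B y)" by (rule norm_cblinfun_apply_le)
      also have "\<dots> \<le> (norm w * (\<beta> * norm x)) * norm (endo_apply B y)"
        by (intro mult_right_mono order_trans[OF norm_endo_apply_le] mult_left_mono U_norm) simp_all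
      also have "\<dots> = (\<beta> * norm (endo_apply B y)) * (norm w * norm x)" by simp
      also have "\<dots> \<le> \<epsilon> * (norm w * norm x)" using small by (intro mult_right_mono) simp_all
      finally show ?thesis .
    qed
    moreover have "norm (endo_apply (A ^ Suc m) ?v) \<le> (norm s * K) * norm (endo_apply (A ^ Suc m) x)"
    proof -
      let ?z = "endo_apply (A ^ Suc m) x"
      have "norm (endo_apply (A ^ Suc m) ?v) \<le> norm (endo_apply s (?U ?z)) * norm y"
        unfolding Av by (rule norm_cblinfun_apply_le)
      also have "\<dots> \<le> (norm s * (\<beta> * norm ?z)) * norm y"
        by (intro mult_right_mono order_trans[OF norm_endo_apply_le] mult_left_mono U_norm) simp_all
      also have "\<dots> = (\<beta> * norm y) * (norm s * norm ?z)" by (simp only: mult_ac)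
      also have "\<dots> \<le> K * (norm s * norm ?z)" using f(5) by (intro mult_right_mono) simp_all
      finally show ?thesis by (simp only: mult_ac)
    qed
    ultimately show ?thesis unfolding diff[symmetric] by blast
  qed
  show ?thesis
  proof (rule drazin_inverse_if_bounded_below)
    show "norm (endo_apply (A ^ m) x) \<le> (norm s * K) * norm (endo_apply (A ^ Suc m) x)" for x
    proof (rule le_if_le_add_epsilon_mult)
      fix \<epsilon> :: real assume "0 < \<epsilon>"
      then obtain v where "norm (endo_apply (A ^ m) x - endo_apply (A ^ Suc m) v) \<le> \<epsilon> * (norm w * norm x)"
        "norm (endo_apply (A ^ Suc m) v) \<le> (norm s * K) * norm (endo_apply (A ^ Suc m) x)"
        using approx by blast
      then show "norm (endo_apply (A ^ m) x) \<le> (norm s * K) * norm (endo_apply (A ^ Suc m) x) + \<epsilon> * (norm w * norm x)"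
        using norm_triangle_sub[of "endo_apply (A ^ m) x" "endo_apply (A ^ Suc m) v"] by linarith
    qed simp
    show "range (endo_apply (A ^ m)) \<subseteq> closure (range (endo_apply (A ^ Suc m)))"
    proof (clarsimp simp: closure_approachable simp del: power_Suc)
      fix x :: 'x and e :: real assume e: "0 < e"
      \<comment> \<open>The added 1 makes the denominator positive and the final inequality
        strict.\<close>
      let ?c = "norm w * norm x + 1"
      have c: "0 < ?c" by (simp add: add_nonneg_pos)
      then obtain v where "norm (endo_apply (A ^ m) x - endo_apply (A ^ Suc m) v) \<le> e / ?c * (norm w * norm x)"
        using approx[of "e / ?c" x] e by (meson divide_pos_pos)
      also have "\<dots> < e" using c e by (simp add: divide_simps)
      finally show "\<exists>v. dist (endo_apply (A ^ Suc m) v) (endo_apply (A ^ m) x) < e"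
        by (auto simp only: dist_norm norm_minus_commute)
    qed
  qed
qed

text \<open>Now the null pair belongs to \<open>A\<close>: its vector \<open>x\<close> enters the
  rank one operator and its functional \<open>\<phi>\<close> is applied to the value at
  \<open>y\<close>, turning \<open>?R ^ m\<close> into the scalar
  \<open>f (endo_apply (B ^ m) y)\<close>. Both conditions on \<open>B\<close> are thus tested by
  functionals \<open>f\<close>: norming ones for the lower bound, and ones annihilating the range of
  \<open>B ^ Suc m\<close> for density.\<close>

theorem drazin_right_if_left_not_invertible:
  fixes A :: "'x::complex_banach endo" and B :: "'y::complex_banach endo"
  assumes s: "is_drazin_inverse m (endo_left A - endo_right B) s"
    and not_inv: "\<nexists>u. is_drazin_inverse 0 A u"
  shows "\<exists>D. is_drazin_inverse m B D"
proof -
  let ?L = "endo_left A :: ('y \<Rightarrow>\<^sub>C\<^sub>L 'x) endo" and ?R = "endo_right B :: ('y \<Rightarrow>\<^sub>C\<^sub>L 'x) endo"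
  have "is_drazin_inverse m (?R - ?L) (- s)"
    using is_drazin_inverse_uminus[OF s] by simp
  then obtain w where w: "?R ^ m = - s * ?R ^ Suc m + w * ?L" "w * ?L = ?L * w" "- s * ?R = ?R * - s"
    using drazin_difference_remainder[OF endo_left_right_commute[symmetric]] by blast
  define u where "u = - s"
  have uR: "u * ?R ^ n = ?R ^ n * u" for n
    using power_commuting_commutes[OF w(3)[symmetric]] by (simp add: u_def)
  obtain K where K: "0 \<le> K" and pair: "\<And>\<epsilon>::real. 0 < \<epsilon> \<Longrightarrow> \<exists>\<phi> x \<beta>. bounded_clinear \<phi> \<and> \<phi> x = 1 \<and> 0 \<le> \<beta> \<and>
    (\<forall>v. cmod (\<phi> v) \<le> \<beta> * norm v) \<and> \<beta> * norm x \<le> K \<and>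
    ((\<forall>v. \<phi> (endo_apply A v) = 0) \<or> \<beta> * norm (endo_apply A x) \<le> \<epsilon>)"
    using not_invertible_null_pair[OF not_inv] by blast
  have approx: "\<exists>c. cmod (f (endo_apply (B ^ m) y) - c) \<le> \<epsilon> * (norm w * \<gamma> * norm y) \<and>
      cmod c \<le> K * norm u * \<gamma> * norm (endo_apply (B ^ Suc m) y) \<and>
      ((\<forall>v. f (endo_apply (B ^ Suc m) v) = 0) \<longrightarrow> c = 0)"
    if \<epsilon>: "0 < \<epsilon>" and f: "bounded_clinear f" "\<And>v. cmod (f v) \<le> \<gamma> * norm v" "0 \<le> \<gamma>" for \<epsilon> f \<gamma> y
  proof -
    obtain \<phi> x \<beta> where \<phi>: "bounded_clinear \<phi>" "\<phi> x = 1" "0 \<le> \<beta>" "\<And>v. cmod (\<phi> v) \<le> \<beta> * norm v"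
      "\<beta> * norm x \<le> K" and null: "(\<forall>v. \<phi> (endo_apply A v) = 0) \<or> \<beta> * norm (endo_apply A x) \<le> \<epsilon>"
      using pair[OF \<epsilon>] by blast
    have lin: "linear \<phi>" using \<phi>(1) by (simp add: bounded_clinear_def bounded_linear.linear)
    let ?U = "rank_one x f :: 'y \<Rightarrow>\<^sub>C\<^sub>L 'x"
    have RV: "cblinfun_apply (endo_apply (?R ^ n) V) y = cblinfun_apply V (endo_apply (B ^ n) y)" for n V y
      by (simp add: endo_right_apply_apply flip: endo_right_power)
    have U_norm: "norm (rank_one z f :: 'y \<Rightarrow>\<^sub>C\<^sub>L 'x) \<le> \<gamma> * norm z" for z
      by (rule norm_rank_one_le[OF f])
    let ?c = "\<phi> (cblinfun_apply (endo_apply (u * ?R ^ Suc m) ?U) y)"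
    have c: "?c = \<phi> (cblinfun_apply (endo_apply u ?U) (endo_apply (B ^ Suc m) y))"
      unfolding uR by (simp only: endo_apply_mult RV)
    have "f (endo_apply (B ^ m) y) = \<phi> (cblinfun_apply (endo_apply (?R ^ m) ?U) y)"
      using \<phi>(1,2) by (simp add: RV rank_one_apply[OF f(1)] bounded_clinear_def)
    also have "\<dots> = ?c + \<phi> (cblinfun_apply (endo_apply (w * ?L) ?U) y)"
      unfolding w(1) u_def[symmetric] by (simp only: endo_apply_left_add cblinfun_apply_add_left linear_add[OF lin])
    finally have diff: "f (endo_apply (B ^ m) y) - ?c = \<phi> (cblinfun_apply (endo_apply (w * ?L) ?U) y)"
      by simp
    have "cmod (\<phi> (cblinfun_apply (endo_apply (w * ?L) ?U) y)) \<le> \<epsilon> * (norm w * \<gamma> * norm y)"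
      using null
    proof
      assume "\<forall>v. \<phi> (endo_apply A v) = 0"
      then have "\<phi> (cblinfun_apply (endo_apply (w * ?L) ?U) y) = 0"
        unfolding w(2) by (simp add: endo_left_apply_apply)
      then show ?thesis using \<epsilon> f(3) by simp
    next
      assume small: "\<beta> * norm (endo_apply A x) \<le> \<epsilon>"
      have "cmod (\<phi> (cblinfun_apply (endo_apply (w * ?L) ?U) y))
          \<le> \<beta> * norm (cblinfun_apply (endo_apply w (rank_one (endo_apply A x) f)) y)"
        using \<phi>(4) by (simp add: endo_left_rank_one[OF f(1)])
      also have "\<dots> \<le> \<beta> * ((norm w * (\<gamma> * norm (endo_apply A x))) * norm y)"
        by (intro mult_left_mono \<phi>(3) order_trans[OF norm_cblinfun_apply_le] mult_right_mono
            order_trans[OF norm_endo_apply_le] U_norm) simp_all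
      also have "\<dots> = (\<beta> * norm (endo_apply A x)) * (norm w * \<gamma> * norm y)" by simp
      also have "\<dots> \<le> \<epsilon> * (norm w * \<gamma> * norm y)" using small f(3) by (intro mult_right_mono) simp_all
      finally show ?thesis .
    qed
    moreover have "cmod ?c \<le> K * norm u * \<gamma> * norm (endo_apply (B ^ Suc m) y)"
    proof -
      let ?z = "endo_apply (B ^ Suc m) y"
      have "cmod ?c \<le> \<beta> * norm (cblinfun_apply (endo_apply u ?U) ?z)" unfolding c by (rule \<phi>(4))
      also have "\<dots> \<le> \<beta> * ((norm u * (\<gamma> * norm x)) * norm ?z)"
        by (intro mult_left_mono \<phi>(3) order_trans[OF norm_cblinfun_apply_le] mult_right_mono
            order_trans[OF norm_endo_apply_le] U_norm) simp_all
      also have "\<dots> = (\<beta> * norm x) * (norm u * \<gamma> * norm ?z)" by (simp only: mult_ac)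
      also have "\<dots> \<le> K * (norm u * \<gamma> * norm ?z)" using \<phi>(5) f(3) by (intro mult_right_mono) simp_all
      finally show ?thesis by (simp only: mult_ac)
    qed
    moreover have "?c = 0" if "\<forall>v. f (endo_apply (B ^ Suc m) v) = 0"
    proof -
      have "endo_apply (?R ^ Suc m) ?U = 0"
        by (intro cblinfun_eqI) (simp only: RV rank_one_apply[OF f(1)] that cblinfun_apply_zero_left
            complex_vector.scale_zero_left)
      then show ?thesis
        by (simp only: endo_apply_mult endo_apply_zero cblinfun_apply_zero_left linear_0[OF lin])
    qed
    ultimately show ?thesis unfolding diff[symmetric] by blast
  qed
  have nonneg: "0 \<le> norm w * \<gamma> * norm y" if "0 \<le> \<gamma>" for \<gamma> :: real and y :: 'y
    using that by simp
  show ?thesis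
  proof (rule drazin_inverse_if_bounded_below)
    fix y
    let ?z = "endo_apply (B ^ m) y" and ?z' = "endo_apply (B ^ Suc m) y"
    show "norm ?z \<le> (2 * K * norm u) * norm ?z'"
    proof (cases "?z = 0")
      case False
      \<comment> \<open>A functional normalised at \<open>?z\<close> turns the scalar estimate into
        the lower bound; its norm bound accounts for the factor 2.\<close>
      then obtain f where f: "bounded_clinear f" "f ?z = 1" "\<And>v. cmod (f v) \<le> 2 / norm ?z * norm v"
        using norming_functional by blast
      have "1 \<le> K * norm u * (2 / norm ?z) * norm ?z'"
      proof (rule le_if_le_add_epsilon_mult)
        fix \<epsilon> :: real assume "0 < \<epsilon>"
        then obtain c where c: "cmod (f ?z - c) \<le> \<epsilon> * (norm w * (2 / norm ?z) * norm y)"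
          "cmod c \<le> K * norm u * (2 / norm ?z) * norm ?z'"
          using approx[OF _ f(1,3), of \<epsilon> y] by auto
        show "1 \<le> K * norm u * (2 / norm ?z) * norm ?z' + \<epsilon> * (norm w * (2 / norm ?z) * norm y)"
          using norm_triangle_sub[of "f ?z" c] c unfolding f(2) norm_one by linarith
      qed (intro nonneg, simp)
      with False show ?thesis by (simp add: divide_simps mult_ac del: power_Suc)
    qed (use K in simp)
  next
    show "range (endo_apply (B ^ m)) \<subseteq> closure (range (endo_apply (B ^ Suc m)))"
    proof (rule subsetI, rule ccontr)
      fix z assume "z \<in> range (endo_apply (B ^ m))" and z: "z \<notin> closure (range (endo_apply (B ^ Suc m)))"
      then obtain y where y: "z = endo_apply (B ^ m) y" by blast
      let ?\<gamma> = "2 / infdist z (range (endo_apply (B ^ Suc m)))"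
      obtain f where f: "bounded_clinear f" "\<And>v. v \<in> range (endo_apply (B ^ Suc m)) \<Longrightarrow> f v = 0" "f z = 1"
        "\<And>v. cmod (f v) \<le> ?\<gamma> * norm v"
        using Hahn_Banach_separation[OF complex_subspace_range_endo z] by blast
      have \<gamma>: "0 \<le> ?\<gamma>" by (simp add: infdist_nonneg)
      \<comment> \<open>Since \<open>f\<close> annihilates the range of \<open>B ^ Suc m\<close>,
        the approximating scalar \<open>c\<close> is 0, so \<open>f z = 1\<close> would be
        arbitrarily small.\<close>
      have "(1 :: real) \<le> 0"
      proof (rule le_if_le_add_epsilon_mult)
        fix \<epsilon> :: real assume "0 < \<epsilon>"
        then obtain c where c: "cmod (f z - c) \<le> \<epsilon> * (norm w * ?\<gamma> * norm y)"
          "(\<forall>v. f (endo_apply (B ^ Suc m) v) = 0) \<longrightarrow> c = 0"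
          using approx[OF _ f(1,4) \<gamma>, of \<epsilon> y] unfolding y by blast
        then have "c = 0" using f(2) by blast
        with c(1) show "1 \<le> 0 + \<epsilon> * (norm w * ?\<gamma> * norm y)" by (simp only: f(3) diff_zero norm_one add_0)
      qed (rule nonneg[OF \<gamma>])
      then show False by simp
    qed
  qed
qed

section \<open>Translation to the original operators and conclusion\<close>

lemma Endo_compose: "Endo (S o\<^sub>C\<^sub>L T) = Endo S * Endo T"
  and Endo_id: "Endo id_cblinfun = 1"
  and Endo_diff: "Endo (S - T) = Endo S - Endo T"
  and Endo_scaleC: "Endo (c *\<^sub>C T) = c *\<^sub>C Endo T"
  by (simp_all add: times_endo.abs_eq one_endo.abs_eq minus_endo.abs_eq scaleC_endo.abs_eq)

lemma Endo_power: "Endo (cblinfun_power T n) = Endo T ^ n"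
  by (induction n) (simp_all add: Endo_id Endo_compose)

lemma ex_endo_iff: "(\<exists>S. P S) \<longleftrightarrow> (\<exists>S. P (Endo S))"
  by (metis cblinfun_of_endo_inverse)

lemma drazin_invertible_iff: "drazin_invertible T \<longleftrightarrow> (\<exists>m S. is_drazin_inverse m (Endo T) S)"
  unfolding drazin_invertible_def is_drazin_inverse_def ex_endo_iff
  by (simp add: Endo_inject flip: Endo_compose Endo_power) blast

lemma cblinfun_invertible_iff: "cblinfun_invertible T \<longleftrightarrow> (\<exists>S. is_drazin_inverse 0 (Endo T) S)"
  unfolding cblinfun_invertible_def is_drazin_inverse_0_iff
    ex_endo_iff
  by (simp add: Endo_inject flip: Endo_compose Endo_id)

lemma Endo_generalized_derivation:
  "Endo (generalized_derivation A B) = endo_left (Endo A) - endo_right (Endo B)"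
  by (rule endo_eqI)
    (simp add: endo_apply_Endo generalized_derivation_apply endo_apply_left_diff endo_left_apply endo_right_apply
      Endo_inverse)

lemma pointwise_diff_iff: "z \<in> pointwise_diff S T \<longleftrightarrow> (\<exists>\<mu>. \<mu> + z \<in> S \<and> \<mu> \<in> T)"
  unfolding pointwise_diff_def by (auto simp: eq_diff_eq add.commute)

theorem theorem3p7:
  fixes A :: "'x::complex_banach \<Rightarrow>\<^sub>C\<^sub>L 'x" and B :: "'y::complex_banach \<Rightarrow>\<^sub>C\<^sub>L 'y"
  assumes "infinite_dimensional TYPE('x)" and "infinite_dimensional TYPE('y)"
  shows "drazin_spectrum (generalized_derivation A B) =
    pointwise_diff (drazin_spectrum A) (spectrum B) \<union>
    pointwise_diff (spectrum A) (drazin_spectrum B)"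
proof (rule set_eqI)
  fix z
  let ?inv = "\<lambda>T. \<exists>s. is_drazin_inverse 0 T s" and ?dr = "\<lambda>T. \<exists>m s. is_drazin_inverse m T s"
  \<comment> \<open>Shifting both coefficients by \<open>\<mu>\<close> leaves the derivation
    unchanged, so every pair \<open>a \<mu>\<close>, \<open>b \<mu>\<close> represents the same
    operator \<open>?\<rho>\<close>.\<close>
  define a where "a \<mu> = Endo A - (\<mu> + z) *\<^sub>C 1" for \<mu>
  have a_alt: "a \<mu> = Endo A - \<mu> *\<^sub>C 1 - z *\<^sub>C 1" for \<mu>
    by (simp add: a_def scaleC_add_left diff_diff_eq)
  define b where "b \<mu> = Endo B - \<mu> *\<^sub>C 1" for \<mu>
  let ?\<rho> = "Endo (generalized_derivation A B - z *\<^sub>C id_cblinfun)"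
  have \<rho>: "?\<rho> = endo_left (a \<mu>) - endo_right (b \<mu>)" for \<mu>
    by (simp add: a_alt b_def Endo_diff Endo_scaleC Endo_id Endo_generalized_derivation endo_left_diff
        endo_right_diff endo_left_scaleC endo_right_scaleC endo_left_one endo_right_one)
  \<comment> \<open>The right side says that \<open>z\<close> avoids both difference sets, where
    \<open>\<mu>\<close> runs over the possible second members of a difference equal to
    \<open>z\<close>.\<close>
  have "?dr ?\<rho> \<longleftrightarrow> (\<forall>\<mu>. (?dr (a \<mu>) \<or> ?inv (b \<mu>)) \<and> (?inv (a \<mu>) \<or> ?dr (b \<mu>)))"
  proof
    assume "?dr ?\<rho>"
    then obtain m s where s: "is_drazin_inverse m ?\<rho> s" by blast
    show "\<forall>\<mu>. (?dr (a \<mu>) \<or> ?inv (b \<mu>)) \<and> (?inv (a \<mu>) \<or> ?dr (b \<mu>))"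
    proof
      fix \<mu>
      note s' = s[unfolded \<rho>[of \<mu>]]
      show "(?dr (a \<mu>) \<or> ?inv (b \<mu>)) \<and> (?inv (a \<mu>) \<or> ?dr (b \<mu>))"
        using drazin_left_if_right_not_invertible[OF s'] drazin_right_if_left_not_invertible[OF s'] by blast
    qed
  next
    assume *: "\<forall>\<mu>. (?dr (a \<mu>) \<or> ?inv (b \<mu>)) \<and> (?inv (a \<mu>) \<or> ?dr (b \<mu>))"
    let ?L = "endo_left (a 0) :: ('y \<Rightarrow>\<^sub>C\<^sub>L 'x) endo" and ?R = "endo_right (b 0) :: ('y \<Rightarrow>\<^sub>C\<^sub>L 'x) endo"
    interpret commuting_pair ?L ?R
      by standard (rule endo_left_right_commute)
    have L: "?L - \<mu> *\<^sub>C 1 = endo_left (a \<mu>)" and R: "?R - \<mu> *\<^sub>C 1 = endo_right (b \<mu>)" for \<mu>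
      by (simp_all add: a_alt b_def endo_left_diff endo_right_diff endo_left_scaleC endo_right_scaleC
          endo_left_one endo_right_one)
    show "?dr ?\<rho>"
      unfolding \<rho>[of 0]
    proof (rule drazin_difference)
      fix \<mu>
      show "(\<exists>s. is_drazin_inverse 0 (?L - \<mu> *\<^sub>C 1) s) \<or> (\<exists>u. is_drazin_inverse 0 (?R - \<mu> *\<^sub>C 1) u) \<or>
        (\<exists>k s l u. is_drazin_inverse k (?L - \<mu> *\<^sub>C 1) s \<and> is_drazin_inverse l (?R - \<mu> *\<^sub>C 1) u)"
        \<comment> \<open>If neither \<open>a \<mu>\<close> nor \<open>b \<mu>\<close> is
          invertible, the two disjunctions make both Drazin invertible.\<close>
        unfolding L R using *[rule_format, of \<mu>] endo_left_drazin[of _ "a \<mu>"] endo_right_drazin[of _ "b \<mu>"]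
        by blast
    qed
  qed
  moreover have "z \<in> drazin_spectrum (generalized_derivation A B) \<longleftrightarrow> \<not> ?dr ?\<rho>"
    by (simp add: drazin_spectrum_def drazin_invertible_iff)
  moreover have "z \<in> pointwise_diff (drazin_spectrum A) (spectrum B) \<longleftrightarrow> (\<exists>\<mu>. \<not> ?dr (a \<mu>) \<and> \<not> ?inv (b \<mu>))"
    and "z \<in> pointwise_diff (spectrum A) (drazin_spectrum B) \<longleftrightarrow> (\<exists>\<mu>. \<not> ?inv (a \<mu>) \<and> \<not> ?dr (b \<mu>))"
    by (simp_all add: drazin_spectrum_def spectrum_def pointwise_diff_iff drazin_invertible_iff
        cblinfun_invertible_iff a_def b_def Endo_diff Endo_scaleC Endo_id)
  ultimately show "z \<in> drazin_spectrum (generalized_derivation A B) \<longleftrightarrow>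
      z \<in> pointwise_diff (drazin_spectrum A) (spectrum B) \<union> pointwise_diff (spectrum A) (drazin_spectrum B)"
    by auto
qed

end
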